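(* Let $n>1$ be an integer, let $p_n(z)=z(z^n-1)$, and let $C_n$ be Chebyshev's method applied to $p_n$. Then for every non-zero root $\omega$ of $p_n$ (i.e. every $\omega$ with $\omega^n=1$), the immediate basin of $\omega$ under $C_n$ is unbounded and simply connected.
   Context: Chebyshev's method applied to a polynomial $p$ is the rational map $C_p(z)=z-\left(1+\frac12 L_p(z)\right)\frac{p(z)}{p'(z)}$, where $L_p(z)=\frac{p(z)p''(z)}{(p'(z))^2}$, viewed as a self-map of the Riemann sphere $\widehat{\mathbb C}$. For $p_n(z)=z(z^n-1)$ one has $C_n(z)=\frac{z^{n+1}\left(n(n+1)(2n+1)z^{2n}-2n(n+1)z^n-n(n-1)\right)}{2\left((n+1)z^n-1\right)^3}$. Every root of $p_n$ is a superattracting fixed point of $C_n$. The basin of attraction of an attracting fixed point $z_0$ of $C_n$ is $\{z\in\widehat{\mathbb C}:\lim_{m\to\infty}C_n^m(z)=z_0\}$, where $C_n^m$ is the $m$-fold iterate; the immediate basin of $z_0$ is the connected component of the basin containing $z_0$. A set is unbounded if it is an unbounded subset of the plane. *)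

theory Defs
  imports "HOL-Analysis.Analysis" "HOL-Computational_Algebra.Polynomial"
begin

section \<open>The Riemann sphere\<close>

datatype riemann_sphere = Plane complex | Infinity

primrec option_of_sphere :: "riemann_sphere \<Rightarrow> complex option" where
  "option_of_sphere (Plane z) = Some z"
| "option_of_sphere Infinity = None"

lemma inj_option_of_sphere: "inj option_of_sphere"
proof (rule injI)
  fix x y :: riemann_sphere
  assume "option_of_sphere x = option_of_sphere y"
  then show "x = y" by (cases x; cases y) auto
qed

lemma surj_option_of_sphere: "surj option_of_sphere"
proof -
  have "y \<in> range option_of_sphere" for y
    by (cases y) (metis option_of_sphere.simps rangeI)+
  then show ?thesis by blast
qed

text \<open>The topology is that of the one-point compactification of the plane. The type is made an
  instance of the topological type classes so that the library notions of limit, connected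
  component and simple connectedness apply to subsets of the sphere.\<close>

instantiation riemann_sphere :: t2_space
begin

definition open_riemann_sphere :: "riemann_sphere set \<Rightarrow> bool" where
  "open_riemann_sphere U \<longleftrightarrow>
     openin (Alexandroff_compactification euclidean) (option_of_sphere ` U)"

instance
proof
  show "open (UNIV :: riemann_sphere set)"
    unfolding open_riemann_sphere_def surj_option_of_sphere UNIV_option_conv
    by (metis openin_topspace topspace_Alexandroff_compactification topspace_euclidean)
  show "open (S \<inter> T)" if "open S" "open T" for S T :: "riemann_sphere set"
    using that by (simp add: open_riemann_sphere_def image_Int[OF inj_option_of_sphere] openin_Int)
  show "open (\<Union>K)" if "\<forall>S\<in>K. open S" for K :: "riemann_sphere set set"
    using that by (auto simp: open_riemann_sphere_def image_Union intro!: openin_Union)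
  show "\<exists>U V. open U \<and> open V \<and> x \<in> U \<and> y \<in> V \<and> U \<inter> V = {}"
    if "x \<noteq> y" for x y :: riemann_sphere
  proof -
    let ?X = "Alexandroff_compactification (euclidean :: complex topology)"
    have "Hausdorff_space ?X"
      by (simp add: Hausdorff_space_Alexandroff_compactification
                    locally_compact_space_euclidean)
    moreover have "option_of_sphere x \<noteq> option_of_sphere y"
      using that inj_option_of_sphere by (auto dest: injD)
    moreover have "z \<in> topspace ?X" for z
      by (cases z) auto
    ultimately obtain U V where UV: "openin ?X U" "openin ?X V" "option_of_sphere x \<in> U"
        "option_of_sphere y \<in> V" "disjnt U V"
      unfolding Hausdorff_space_def by (elim allE impE exE) auto
    have "option_of_sphere ` (option_of_sphere -` W) = W" for W
      by (simp add: surj_image_vimage_eq surj_option_of_sphere)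
    then show ?thesis
      using UV by (intro exI[of _ "option_of_sphere -` U"] exI[of _ "option_of_sphere -` V"])
        (auto simp: open_riemann_sphere_def disjnt_def)
  qed
qed

end

lemma open_riemann_sphere_iff:
  "open U \<longleftrightarrow> open (Plane -` U) \<and> (Infinity \<in> U \<longrightarrow> compact (- (Plane -` U)))"
proof -
  have Some_iff: "Some z \<in> option_of_sphere ` U \<longleftrightarrow> z \<in> Plane -` U" for z
    by (metis image_iff inj_image_mem_iff inj_option_of_sphere option_of_sphere.simps(1) vimage_eq)
  have None_iff: "None \<in> option_of_sphere ` U \<longleftrightarrow> Infinity \<in> U"
    by (metis inj_image_mem_iff inj_option_of_sphere option_of_sphere.simps(2))
  have 1: "option_of_sphere ` U = Some ` V \<longleftrightarrow> Infinity \<notin> U \<and> V = Plane -` U" for V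
    unfolding set_eq_iff split_option_all Some_iff None_iff by auto
  have 2: "option_of_sphere ` U = insert None (Some ` (- C)) \<longleftrightarrow> Infinity \<in> U \<and> C = - (Plane -` U)"
    for C
    unfolding set_eq_iff split_option_all Some_iff None_iff by auto
  show ?thesis
    unfolding open_riemann_sphere_def openin_Alexandroff_compactification
    by (auto simp: 1 2 Compl_eq_Diff_UNIV[symmetric] compact_imp_closed open_closed)
qed

definition unbounded_in_plane :: "riemann_sphere set \<Rightarrow> bool" where
  "unbounded_in_plane A \<longleftrightarrow> A \<subseteq> range Plane \<and> \<not> bounded (Plane -` A)"

section \<open>Chebyshev's method as a rational self-map of the sphere\<close>

text \<open>The self-map of the sphere induced by a rational function \<^term>\<open>f\<close>. All values are taken as
  limits, so the values that \<^term>\<open>f\<close> gets at its singularities from the convention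
  \<^prop>\<open>x / 0 = 0\<close> play no role: poles are sent to \<^term>\<open>Infinity\<close> and removable singularities are
  filled in.\<close>

definition sphere_map :: "(complex \<Rightarrow> complex) \<Rightarrow> riemann_sphere \<Rightarrow> riemann_sphere" where
  "sphere_map f w =
     (case w of
        Plane z \<Rightarrow> Lim (at z) (\<lambda>\<zeta>. Plane (f \<zeta>))
      | Infinity \<Rightarrow> Lim at_infinity (\<lambda>\<zeta>. Plane (f \<zeta>)))"

definition chebyshev_L :: "complex poly \<Rightarrow> complex \<Rightarrow> complex" where
  "chebyshev_L p z = poly p z * poly (pderiv (pderiv p)) z / (poly (pderiv p) z)\<^sup>2"

definition chebyshev_map :: "complex poly \<Rightarrow> riemann_sphere \<Rightarrow> riemann_sphere" where
  "chebyshev_map p =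
     sphere_map (\<lambda>z. z - (1 + 1/2 * chebyshev_L p z) * (poly p z / poly (pderiv p) z))"

definition p_poly :: "nat \<Rightarrow> complex poly" where
  "p_poly n = [:0, 1:] * (monom 1 n - 1)"

section \<open>Basins of attraction\<close>

definition basin :: "('a \<Rightarrow> 'a) \<Rightarrow> 'a \<Rightarrow> 'a :: topological_space set" where
  "basin f z0 = {z. (\<lambda>m. (f ^^ m) z) \<longlonglongrightarrow> z0}"

definition immediate_basin :: "('a \<Rightarrow> 'a) \<Rightarrow> 'a \<Rightarrow> 'a :: topological_space set" where
  "immediate_basin f z0 = connected_component_set (basin f z0) z0"

end

theory Submission
  imports Defs "HOL-Complex_Analysis.Complex_Analysis"
begin

text \<open>
The map \<open>z \<mapsto> C\<^sub>n z\<close> commutes with the rotation by each root \<open>\<omega>\<close>, so only the root \<open>1\<close> and its immediate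
basin \<open>U\<close> have to be considered.

\<^emph>\<open>Unboundedness.\<close> On \<open>[1, \<infinity>)\<close> the map contracts distances to \<open>1\<close> and preserves the interval, so this
ray is contained in \<open>U\<close> (\<open>real_ray_subset_plane_basin\<close>).

\<^emph>\<open>Simple connectedness.\<close> If a domain \<open>\<Omega>\<close> contains \<open>U\<close>, contains no pole and has no holes, then the
maximum principle shows that \<open>U\<close> has no holes either: the iterates map the inside of a loop in \<open>U\<close> into
\<open>\<Omega>\<close> and converge there, because they do so on the loop (\<open>simply_connected_basin\<close>). So it remains to
enclose \<open>U\<close> in such a domain. This takes two steps.

The lines through \<open>0\<close> with direction \<open>exp (\<plusminus> i \<pi> / n)\<close> are closed and invariant, since \<open>z ^ n\<close> is real on
them, and do not contain \<open>1\<close>. Hence \<open>U\<close> does not meet them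
(\<open>plane_basin_avoids_invariant_line\<close>), that is, \<open>U\<close> lies in the sector \<open>\<bar>Arg z\<bar> < \<pi> / n\<close>. There is only
one pole in this sector, the positive number \<open>z0\<close> with \<open>(n + 1) * z0 ^ n = 1\<close>.

In this sector \<open>U\<close> does not meet the segment from \<open>0\<close> to \<open>z0\<close>. For the total argument of the factors of
\<open>C\<^sub>n z\<close> is continuous on \<open>U\<close>, vanishes at \<open>1\<close>, would be \<open>- 2 * \<pi>\<close> on the segment, and never takes the
value \<open>- \<pi>\<close>, because \<open>U\<close> is mapped into itself and does not contain any point of the negative real
axis (\<open>invariant_connected_avoids_pole_segment\<close>). The sector without this segment is star-shaped about
\<open>1\<close> and serves as \<open>\<Omega>\<close>.
\<close>

section \<open>Basins and the maximum principle\<close>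

text \<open>The set of values \<open>b \<in> R\<close> taken by \<open>h\<close> on \<open>V\<close> is open and closed in \<open>R\<close>, with a uniform gap: if
\<open>b \<in> R\<close> is omitted, then the maximum principle for \<open>1 / (h - b)\<close> keeps \<open>h ` V\<close> as far from \<open>b\<close> as
\<open>h ` frontier V\<close> is from \<open>R\<close>. Connectedness leaves all of \<open>R\<close> or nothing, and \<open>R\<close> is too large to be
contained in the bounded set \<open>h ` V\<close>.\<close>

lemma holomorphic_image_avoids_unbounded_connected:
  fixes h :: "complex \<Rightarrow> complex"
  assumes V: "open V" "bounded V"
    and hol: "h holomorphic_on V" and cont: "continuous_on (closure V) h"
    and R: "closed R" "connected R" "\<not> bounded R"
    and fr: "h ` frontier V \<inter> R = {}"
  shows "h ` V \<inter> R = {}"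
proof -
  have cfr: "compact (frontier V)"
    using V(2) by (simp add: compact_frontier_bounded)
  have sub: "frontier V \<subseteq> closure V" by (simp add: frontier_def)
  have "compact (h ` frontier V)"
    by (rule compact_continuous_image[OF continuous_on_subset[OF cont sub] cfr])
  then obtain d where d: "d > 0" "\<And>x y. x \<in> h ` frontier V \<Longrightarrow> y \<in> R \<Longrightarrow> d \<le> dist x y"
    using separate_compact_closed[OF _ R(1) fr] by blast
  have gap: "d \<le> dist (h v) b" if b: "b \<in> R" "b \<notin> h ` V" and v: "v \<in> V" for b v
  proof -
    have nz: "h z \<noteq> b" if "z \<in> closure V" for z
      using that b d(1) d(2)[of "h z" b] V(1)
      by (cases "z \<in> V") (auto simp: frontier_def interior_open)
    have "norm (1 / (h v - b)) \<le> 1 / d"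
    proof (rule maximum_modulus_frontier[where S=V and f="\<lambda>z. 1 / (h z - b)"])
      show "(\<lambda>z. 1 / (h z - b)) holomorphic_on interior V"
        using hol b(2) V(1) by (auto intro!: holomorphic_intros simp: interior_open)
      show "continuous_on (closure V) (\<lambda>z. 1 / (h z - b))"
        using cont nz by (auto intro!: continuous_intros)
      show "norm (1 / (h z - b)) \<le> 1 / d" if "z \<in> frontier V" for z
        using d(1) d(2)[of "h z" b] that b(1)
        by (auto simp: norm_divide dist_norm intro!: divide_left_mono mult_pos_pos)
    qed (use V v in auto)
    moreover have "norm (h v - b) > 0" using nz closure_subset v by auto
    ultimately show ?thesis using d(1)
      by (simp add: norm_divide dist_norm field_simps)
  qed
  \<comment> \<open>By \<open>gap\<close> the balls of radius \<open>d\<close> around taken and around omitted values do not meet in \<open>R\<close>.\<close>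
  define P where "P = (\<Union>b\<in>R \<inter> h ` V. ball b d)"
  define Q where "Q = (\<Union>b\<in>R - h ` V. ball b d)"
  have "P \<inter> Q \<inter> R = {}"
  proof (rule ccontr)
    assume "P \<inter> Q \<inter> R \<noteq> {}"
    then obtain x b c where x: "x \<in> R" and b: "b \<in> h ` V" "dist b x < d"
      and c: "c \<in> R" "c \<notin> h ` V" "dist c x < d"
      by (simp only: P_def Q_def ex_in_conv[symmetric] Int_iff UN_iff mem_ball Diff_iff) blast
    show False
    proof (cases "x \<in> h ` V")
      case True
      then show False using gap[OF c(1,2)] c(3) by (force simp: dist_commute)
    next
      case False
      then show False using gap[OF x False] b by (force simp: dist_commute)
    qed
  qed
  moreover have "R \<subseteq> P \<union> Q" unfolding P_def Q_def using d(1) by force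
  moreover have "open P" "open Q" unfolding P_def Q_def by auto
  ultimately have "P \<inter> R = {} \<or> Q \<inter> R = {}"
    using connectedD[OF R(2)] by blast
  moreover have "R \<inter> h ` V \<subseteq> P \<inter> R" "R - h ` V \<subseteq> Q \<inter> R"
    unfolding P_def Q_def using d(1) by force+
  moreover have "\<not> R \<subseteq> h ` V"
  proof
    assume "R \<subseteq> h ` V"
    also have "\<dots> \<subseteq> h ` closure V" using closure_subset by blast
    finally have "R \<subseteq> h ` closure V" .
    moreover have "bounded (h ` closure V)"
      using V(2) cont by (intro compact_imp_bounded compact_continuous_image) (auto simp: compact_closure)
    ultimately show False using R(3) bounded_subset by blast
  qed
  ultimately show ?thesis by blast
qed

lemma attracting_ball_iterates:
  fixes f :: "'a :: metric_space \<Rightarrow> 'a"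
  assumes att: "\<And>z. z \<in> ball w r \<Longrightarrow> dist (f z) w \<le> dist z w / 2"
    and z: "z \<in> ball w r"
  shows "(f ^^ m) z \<in> ball w r" and "(\<lambda>m. (f ^^ m) z) \<longlonglongrightarrow> w"
proof -
  have *: "(f ^^ m) z \<in> ball w r \<and> dist ((f ^^ m) z) w \<le> dist z w * (1/2) ^ m" for m
  proof (induction m)
    case (Suc m)
    from att[of "(f ^^ m) z"] Suc have "dist ((f ^^ Suc m) z) w \<le> dist ((f ^^ m) z) w / 2" by simp
    moreover have "dist ((f ^^ m) z) w < r" using Suc by (simp add: dist_commute)
    ultimately show ?case using Suc zero_le_dist[of "(f ^^ m) z" w]
      by (auto simp: dist_commute simp del: zero_le_dist)
  qed (use z in auto)
  then show "(f ^^ m) z \<in> ball w r" by blast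
  have "(\<lambda>m. dist ((f ^^ m) z) w) \<longlonglongrightarrow> 0"
  proof (rule tendsto_sandwich[of "\<lambda>_. 0" _ _ "\<lambda>m. dist z w * (1/2) ^ m"])
    show "(\<lambda>m. dist z w * (1 / 2) ^ m) \<longlonglongrightarrow> 0"
      by (intro tendsto_mult_right_zero LIMSEQ_power_zero) auto
  qed (use * in auto)
  then show "(\<lambda>m. (f ^^ m) z) \<longlonglongrightarrow> w" using tendsto_dist_iff by blast
qed

lemma iterates_tail:
  fixes f :: "'a :: topological_space \<Rightarrow> 'a"
  shows "(\<lambda>m. (f ^^ m) ((f ^^ k) z)) \<longlonglongrightarrow> w \<longleftrightarrow> (\<lambda>m. (f ^^ m) z) \<longlonglongrightarrow> w"
  using LIMSEQ_ignore_initial_segment[of "\<lambda>m. (f ^^ m) z" w k]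
    LIMSEQ_offset[of "\<lambda>m. (f ^^ m) z" k w]
  by (auto simp: funpow_add)

text \<open>Once an orbit has entered the ball it stays there, so the open sets of points that are in the ball at
time \<open>m\<close> increase with \<open>m\<close> and finitely many of them suffice to cover \<open>T\<close>.\<close>

lemma compact_uniformly_attracted:
  fixes f :: "'a :: metric_space \<Rightarrow> 'a"
  assumes r: "r > 0"
    and att: "\<And>z. z \<in> ball w r \<Longrightarrow> dist (f z) w \<le> dist z w / 2"
    and cont: "\<And>m. continuous_on U (f ^^ m)"
    and lim: "\<And>z. z \<in> U \<Longrightarrow> (\<lambda>m. (f ^^ m) z) \<longlonglongrightarrow> w"
    and T: "compact T" "T \<subseteq> U"
  shows "\<exists>M. (f ^^ M) ` T \<subseteq> ball w r"
proof -
  have "\<exists>A. open A \<and> A \<inter> T = (f ^^ m) -` ball w r \<inter> T" for m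
    using continuous_on_subset[OF cont T(2)] open_ball
    by (meson continuous_on_open_invariant)
  then obtain A where A: "\<And>m. open (A m)" "\<And>m. A m \<inter> T = (f ^^ m) -` ball w r \<inter> T"
    by metis
  have "T \<subseteq> (\<Union>m. A m)"
  proof
    fix x assume x: "x \<in> T"
    then have "\<forall>\<^sub>F m in sequentially. (f ^^ m) x \<in> ball w r"
      using lim[of x] T r by (intro topological_tendstoD) auto
    then obtain m where "(f ^^ m) x \<in> ball w r" using eventually_happens sequentially_bot by blast
    with x A(2)[of m] show "x \<in> (\<Union>m. A m)" by blast
  qed
  then obtain C where C: "finite C" "T \<subseteq> (\<Union>m\<in>C. A m)"
    using compactE_image[OF T(1)] A(1) by (metis UNIV_I subset_UNIV)
  define M where "M = Max (insert 0 C)"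
  have "(f ^^ M) x \<in> ball w r" if x: "x \<in> T" for x
  proof -
    obtain m where m: "m \<in> C" "(f ^^ m) x \<in> ball w r" using C(2) A(2) x by fast
    have "m \<le> M" unfolding M_def using C(1) m(1) by simp
    then have "(f ^^ M) x = (f ^^ (M - m)) ((f ^^ m) x)"
      by (metis comp_apply funpow_add le_add_diff_inverse2)
    then show ?thesis using attracting_ball_iterates(1)[OF att m(2)] by simp
  qed
  then show ?thesis by blast
qed

lemma continuous_on_iterates:
  fixes f :: "'a :: topological_space \<Rightarrow> 'a"
  assumes "continuous_on U f" "f ` U \<subseteq> U"
  shows "continuous_on U (f ^^ m)" and "(f ^^ m) ` U \<subseteq> U"
proof -
  have "continuous_on U (f ^^ m) \<and> (f ^^ m) ` U \<subseteq> U"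
  proof (induction m)
    case (Suc m)
    then have "continuous_on U (f \<circ> (f ^^ m))"
      by (intro continuous_on_compose continuous_on_subset[OF assms(1)]) auto
    with Suc assms(2) show ?case by (auto simp: image_subset_iff)
  qed auto
  then show "continuous_on U (f ^^ m)" "(f ^^ m) ` U \<subseteq> U" by auto
qed

text \<open>A substitute for the Riemann--Hurwitz argument. Let \<open>\<gamma>\<close> be a loop in the immediate basin \<open>U\<close>. The
iterates map \<open>\<gamma>\<close> into \<open>U\<close>, hence into the domain \<open>\<Omega>\<close> on which \<open>f\<close> is holomorphic; since every point
outside \<open>\<Omega>\<close> escapes to infinity along a connected set outside \<open>\<Omega>\<close>, the previous lemmas show
inductively that the iterates also map the inside of \<open>\<gamma>\<close> into \<open>\<Omega>\<close>. So no pole is ever met there, and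
the maximum principle carries the convergence from \<open>\<gamma>\<close> to its inside. Hence the inside lies in the
basin, by maximality in \<open>U\<close>, and \<open>\<gamma>\<close> has winding number zero around each point of the complement.\<close>

theorem simply_connected_basin:
  fixes f :: "complex \<Rightarrow> complex"
  assumes U: "open U" "connected U" "f ` U \<subseteq> U"
    and lim: "\<And>z. z \<in> U \<Longrightarrow> (\<lambda>m. (f ^^ m) z) \<longlonglongrightarrow> w"
    and r: "r > 0" and att: "\<And>z. z \<in> ball w r \<Longrightarrow> dist (f z) w \<le> dist z w / 2"
    and hol: "f holomorphic_on \<Omega>" and sub: "U \<subseteq> \<Omega>"
    and escape: "\<And>b. b \<notin> \<Omega> \<Longrightarrow> \<exists>R. b \<in> R \<and> closed R \<and> connected R \<and> \<not> bounded R \<and> R \<inter> \<Omega> = {}"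
    and maximal: "\<And>K. connected K \<Longrightarrow> K \<inter> U \<noteq> {} \<Longrightarrow>
        (\<And>z m. z \<in> K \<Longrightarrow> (f ^^ m) z \<in> \<Omega>) \<Longrightarrow>
        (\<And>z. z \<in> K \<Longrightarrow> (\<lambda>m. (f ^^ m) z) \<longlonglongrightarrow> w) \<Longrightarrow> K \<subseteq> U"
  shows "simply_connected U"
proof -
  have cf: "continuous_on \<Omega> f" using hol holomorphic_on_imp_continuous_on by blast
  have cU: "continuous_on U (f ^^ m)" and fU: "(f ^^ m) ` U \<subseteq> U" for m
    using continuous_on_iterates[OF continuous_on_subset[OF cf sub] U(3)] by auto
  have ins: "inside T \<subseteq> U" if T: "compact T" "connected T" "T \<subseteq> U" "T \<noteq> {}" for T
  proof -
    define V where "V = inside T"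
    have V: "open V" "bounded V"
      unfolding V_def using T by (auto intro: open_inside bounded_inside compact_imp_bounded compact_imp_closed)
    have frV: "frontier V \<subseteq> T" unfolding V_def
      by (rule frontier_inside_subset[OF compact_imp_closed[OF T(1)]])
    have clV: "closure V \<subseteq> V \<union> T"
      using frV closure_Un_frontier[of V] by blast
    \<comment> \<open>The escaping set through a point outside \<open>\<Omega>\<close> misses \<open>T\<close>, so that point is not enclosed by \<open>T\<close>.\<close>
    have V\<Omega>: "V \<subseteq> \<Omega>"
    proof
      fix b assume b: "b \<in> V"
      show "b \<in> \<Omega>"
      proof (rule ccontr)
        assume "b \<notin> \<Omega>"
        then obtain R where R: "b \<in> R" "connected R" "\<not> bounded R" "R \<inter> \<Omega> = {}"
          using escape by blast
        have "R \<subseteq> connected_component_set (- T) b"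
          using R T(3) sub by (intro connected_component_maximal) auto
        moreover have "bounded (connected_component_set (- T) b)"
          using b by (simp add: V_def inside_def)
        ultimately show False using R(3) bounded_subset by blast
      qed
    qed
    have step: "(f ^^ m) holomorphic_on V \<and> continuous_on (closure V) (f ^^ m) \<and>
        (f ^^ m) ` (V \<union> T) \<subseteq> \<Omega>" for m
    proof (induction m)
      case 0
      then show ?case using V\<Omega> T(3) sub by (auto simp: id_def)
    next
      case (Suc m)
      have h: "(f ^^ Suc m) holomorphic_on V"
        using holomorphic_on_compose_gen[of "f ^^ m" V f \<Omega>] Suc hol by (auto simp: image_Un)
      have c: "continuous_on (closure V) (f ^^ Suc m)"
      proof -
        have "continuous_on (closure V) (f \<circ> (f ^^ m))"
          by (rule continuous_on_compose) (use Suc cf clV in \<open>auto intro: continuous_on_subset\<close>)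
        then show ?thesis by simp
      qed
      have frU: "(f ^^ Suc m) ` frontier V \<subseteq> U" using frV T(3) fU[of "Suc m"] by blast
      have "(f ^^ Suc m) ` V \<subseteq> \<Omega>"
      proof (rule ccontr)
        assume "\<not> ?thesis"
        then obtain b where b: "b \<in> (f ^^ Suc m) ` V" "b \<notin> \<Omega>" by blast
        then obtain R where R: "b \<in> R" "closed R" "connected R" "\<not> bounded R" "R \<inter> \<Omega> = {}"
          using escape by blast
        have "(f ^^ Suc m) ` V \<inter> R = {}"
          by (rule holomorphic_image_avoids_unbounded_connected[OF V h c R(2-4)])
            (use frU sub R(5) in blast)
        with b R(1) show False by blast
      qed
      moreover have "(f ^^ Suc m) ` T \<subseteq> \<Omega>" using T(3) fU[of "Suc m"] sub by blast
      ultimately show ?case using h c by (simp only: image_Un Un_subset_iff)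
    qed
    obtain M where M: "(f ^^ M) ` T \<subseteq> ball w r"
      using compact_uniformly_attracted[OF r att cU lim T(1,3)] by blast
    have "compact ((f ^^ M) ` T)"
      by (rule compact_continuous_image[OF continuous_on_subset[OF cU T(3)] T(1)])
    \<comment> \<open>The maximum principle yields a closed ball, hence the slightly smaller radius \<open>s\<close>.\<close>
    then obtain s where s: "s < r" "(f ^^ M) ` T \<subseteq> cball w s"
    proof -
      have "compact ((\<lambda>z. dist w z) ` (f ^^ M) ` T)"
        by (rule compact_continuous_image) (auto intro!: continuous_intros \<open>compact ((f ^^ M) ` T)\<close>)
      then obtain s where "s \<in> (\<lambda>z. dist w z) ` (f ^^ M) ` T" "\<forall>t \<in> (\<lambda>z. dist w z) ` (f ^^ M) ` T. t \<le> s"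
        using compact_attains_sup T(4) by (metis image_is_empty)
      then have "s < r" "(f ^^ M) ` T \<subseteq> cball w s" using M by auto
      then show thesis by (rule that)
    qed
    have "(f ^^ M) v \<in> ball w r" if v: "v \<in> V" for v
    proof -
      have "norm ((f ^^ M) v - w) \<le> s"
      proof (rule maximum_modulus_frontier[where S=V and f="\<lambda>z. (f ^^ M) z - w"])
        show "norm ((f ^^ M) z - w) \<le> s" if "z \<in> frontier V" for z
        proof -
          have "(f ^^ M) z \<in> cball w s" using that frV s(2) by blast
          then show ?thesis by (simp add: dist_norm norm_minus_commute)
        qed
      qed (use step[of M] V v in \<open>auto intro!: holomorphic_intros continuous_intros simp: interior_open\<close>)
      then show ?thesis using s(1) by (auto simp: dist_norm norm_minus_commute)
    qed
    then have conv: "(\<lambda>m. (f ^^ m) v) \<longlonglongrightarrow> w" if "v \<in> V" for v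
      using attracting_ball_iterates(2)[OF att] iterates_tail that by blast
    have "T \<union> V \<subseteq> U"
    proof (rule maximal)
      show "connected (T \<union> V)" unfolding V_def
        using connected_with_inside T compact_imp_closed by blast
      show "(f ^^ m) z \<in> \<Omega>" if "z \<in> T \<union> V" for z m using step[of m] that by blast
      show "(\<lambda>m. (f ^^ m) z) \<longlonglongrightarrow> w" if "z \<in> T \<union> V" for z
        using that conv lim T(3) by blast
    qed (use T in auto)
    then show ?thesis by (auto simp: V_def)
  qed
  show ?thesis
  proof (subst simply_connected_eq_winding_number_zero[OF U(1)], intro conjI allI impI U(2), elim conjE)
    fix \<gamma> :: "real \<Rightarrow> complex" and z
    assume g: "path \<gamma>" "path_image \<gamma> \<subseteq> U" "pathfinish \<gamma> = pathstart \<gamma>" "z \<notin> U"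
    have "inside (path_image \<gamma>) \<subseteq> U"
      by (rule ins) (use g in \<open>auto simp: compact_path_image connected_path_image\<close>)
    then have "z \<in> outside (path_image \<gamma>)"
      using g(2,4) inside_Un_outside[of "path_image \<gamma>"] by blast
    then show "winding_number \<gamma> z = 0" using winding_number_zero_in_outside g by blast
  qed
qed

section \<open>Limits on the sphere\<close>

lemma open_Plane_vimage: "open U \<Longrightarrow> open (Plane -` U)"
  by (simp add: open_riemann_sphere_iff)

lemma open_Plane_image: "open S \<Longrightarrow> open (Plane ` S)"
proof -
  have "Plane -` (Plane ` S) = S" by auto
  then show "open S \<Longrightarrow> open (Plane ` S)" by (auto simp: open_riemann_sphere_iff)
qed

lemma tendsto_Plane_iff:
  "((\<lambda>x. Plane (g x)) \<longlongrightarrow> Plane z) F \<longleftrightarrow> (g \<longlongrightarrow> z) F"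
proof
  assume *: "((\<lambda>x. Plane (g x)) \<longlongrightarrow> Plane z) F"
  show "(g \<longlongrightarrow> z) F"
  proof (rule topological_tendstoI)
    fix S assume "open S" "z \<in> S"
    then have "\<forall>\<^sub>F x in F. Plane (g x) \<in> Plane ` S"
      using * open_Plane_image by (intro topological_tendstoD) auto
    then show "\<forall>\<^sub>F x in F. g x \<in> S" by (rule eventually_mono) auto
  qed
next
  assume *: "(g \<longlongrightarrow> z) F"
  show "((\<lambda>x. Plane (g x)) \<longlongrightarrow> Plane z) F"
  proof (rule topological_tendstoI)
    fix U assume "open U" "Plane z \<in> U"
    then have "\<forall>\<^sub>F x in F. g x \<in> Plane -` U"
      using * open_Plane_vimage by (intro topological_tendstoD) auto
    then show "\<forall>\<^sub>F x in F. Plane (g x) \<in> U" by simp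
  qed
qed

lemma tendsto_Plane_Infinity:
  assumes "filterlim g at_infinity F"
  shows "((\<lambda>x. Plane (g x)) \<longlongrightarrow> Infinity) F"
proof (rule topological_tendstoI)
  fix U assume "open U" "Infinity \<in> U"
  then have "bounded (- (Plane -` U))"
    by (simp add: open_riemann_sphere_iff compact_imp_bounded)
  then obtain b where b: "b > 0" "\<And>x. x \<in> - (Plane -` U) \<Longrightarrow> norm x \<le> b"
    unfolding bounded_pos by blast
  have "\<forall>\<^sub>F x in F. b + 1 \<le> norm (g x)"
    using assms b(1) unfolding filterlim_at_infinity[OF order_refl] by simp
  then show "\<forall>\<^sub>F x in F. Plane (g x) \<in> U"
    by (rule eventually_mono) (use b(2) in force)
qed

lemma sphere_map_Plane:
  assumes "((\<lambda>\<zeta>. f \<zeta>) \<longlongrightarrow> c) (at z)"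
  shows "sphere_map f (Plane z) = Plane c"
  using assms by (auto simp: sphere_map_def tendsto_Plane_iff intro!: tendsto_Lim)

lemma sphere_map_pole:
  assumes "filterlim f at_infinity (at z)"
  shows "sphere_map f (Plane z) = Infinity"
  using tendsto_Plane_Infinity[OF assms] by (auto simp: sphere_map_def intro!: tendsto_Lim)

lemma sphere_map_Infinity:
  assumes "filterlim f at_infinity at_infinity"
  shows "sphere_map f Infinity = Infinity"
  using tendsto_Lim[OF trivial_limit_at_infinity tendsto_Plane_Infinity[OF assms]]
  by (simp add: sphere_map_def)

section \<open>Chebyshev's method as an explicit rational function\<close>

text \<open>Chebyshev's method for \<open>p_poly n\<close> has the form \<open>z \<mapsto> z * \<Phi> (z ^ n)\<close> with a rational function \<open>\<Phi>\<close> that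
has real coefficients. This form shows at a glance that the map commutes with rotations by \<open>n\<close>-th
roots of unity and preserves the lines through \<open>0\<close> on which \<open>z ^ n\<close> is real. The type is kept general
because the map is used both on the plane and on the real line.\<close>

definition cheb_factor :: "nat \<Rightarrow> 'a::real_normed_field \<Rightarrow> 'a" where
  "cheb_factor n w = w * (of_nat n * (of_nat n + 1) * (2 * of_nat n + 1) * w\<^sup>2
      - 2 * of_nat n * (of_nat n + 1) * w - of_nat n * (of_nat n - 1))
      / (2 * ((of_nat n + 1) * w - 1) ^ 3)"

definition cheb :: "nat \<Rightarrow> 'a::real_normed_field \<Rightarrow> 'a" where
  "cheb n z = z * cheb_factor n (z ^ n)"

definition nonpole :: "nat \<Rightarrow> 'a::real_normed_field \<Rightarrow> bool" where
  "nonpole n z \<longleftrightarrow> (of_nat n + 1) * z ^ n \<noteq> 1"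

lemma poly_p_poly: "poly (p_poly n) z = z * (z ^ n - 1)"
  by (simp add: p_poly_def poly_monom)

lemma poly_pderiv_p_poly:
  assumes "n > 0" shows "poly (pderiv (p_poly n)) z = (of_nat n + 1) * z ^ n - 1"
proof -
  have "z * z ^ (n - 1) = z ^ n" using assms by (simp add: power_eq_if)
  then show ?thesis
    by (simp add: p_poly_def pderiv_mult pderiv_diff pderiv_monom poly_monom pderiv_pCons algebra_simps)
qed

lemma poly_pderiv2_p_poly:
  assumes "n > 0"
  shows "z * poly (pderiv (pderiv (p_poly n))) z = of_nat n * (of_nat n + 1) * z ^ n"
proof -
  have "pderiv (p_poly n) = monom (of_nat n + 1) n - 1"
    using poly_pderiv_p_poly[OF assms] by (intro poly_eqI_degree_lead_coeff poly_ext) (simp add: poly_monom)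
  then have "z * poly (pderiv (pderiv (p_poly n))) z
      = of_nat n * (of_nat n + 1) * (z * z ^ (n - 1))"
    by (simp add: pderiv_diff pderiv_monom poly_monom)
  also have "z * z ^ (n - 1) = z ^ n" using assms by (simp add: power_eq_if)
  finally show ?thesis .
qed

lemma chebyshev_formula:
  assumes n: "n > 0" and z: "nonpole n z"
  shows "z - (1 + 1/2 * chebyshev_L (p_poly n) z) * (poly (p_poly n) z / poly (pderiv (p_poly n)) z)
     = cheb n z"
proof -
  define N :: complex where "N = of_nat n"
  define w where "w = z ^ n"
  define d where "d = (N + 1) * w - 1"
  define q where "q = poly (pderiv (pderiv (p_poly n))) z"
  have d: "d \<noteq> 0" using z by (simp add: nonpole_def d_def N_def w_def)
  have q: "z * q = N * (N + 1) * w" using poly_pderiv2_p_poly[OF n] by (simp add: q_def N_def w_def)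
  have "z - (1 + 1/2 * chebyshev_L (p_poly n) z) * (poly (p_poly n) z / poly (pderiv (p_poly n)) z)
      = z - (1 + 1/2 * ((z * (w - 1)) * q / d\<^sup>2)) * (z * (w - 1) / d)"
    by (simp add: chebyshev_L_def poly_p_poly poly_pderiv_p_poly[OF n] q_def d_def w_def N_def)
  also have "\<dots> = z * (2 * d ^ 3 - 2 * (w - 1) * d\<^sup>2 - (z * q) * (w - 1)\<^sup>2) / (2 * d ^ 3)"
    using d by (simp add: field_simps power2_eq_square power3_eq_cube)
  also have "2 * d ^ 3 - 2 * (w - 1) * d\<^sup>2 - (z * q) * (w - 1)\<^sup>2
      = w * (N * (N + 1) * (2 * N + 1) * w\<^sup>2 - 2 * N * (N + 1) * w - N * (N - 1))"
    unfolding q d_def by (simp add: algebra_simps power2_eq_square power3_eq_cube)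
  finally show ?thesis by (simp add: cheb_def cheb_factor_def N_def w_def d_def)
qed

text \<open>The derivative of Chebyshev's method is \<open>p\<^sup>2 * (3 * p''\<^sup>2 - p' * p''') / (2 * p' ^ 4)\<close>. Its zero at
\<open>z ^ n = 1\<close> makes the roots superattracting, and its sign makes the map increasing on \<open>[1, \<infinity>)\<close>.\<close>

lemma has_field_derivative_cheb:
  fixes z :: "'a::real_normed_field"
  assumes n: "n > 0" and z: "nonpole n z"
  shows "(cheb n has_field_derivative
     (of_nat n * (of_nat n + 1) * z ^ n * (z ^ n - 1)\<^sup>2 *
       ((of_nat n + 1) * (2 * of_nat n + 1) * z ^ n + (of_nat n - 1))
       / (2 * ((of_nat n + 1) * z ^ n - 1) ^ 4))) (at z)"
proof -
  define N :: 'a where "N = of_nat n"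
  define w where "w = z ^ n"
  define d where "d = (N + 1) * w - 1"
  define A where "A = w * (N * (N + 1) * (2 * N + 1) * w\<^sup>2 - 2 * N * (N + 1) * w - N * (N - 1))"
  define A' where "A' = 3 * N * (N + 1) * (2 * N + 1) * w\<^sup>2 - 4 * N * (N + 1) * w - N * (N - 1)"
  have d: "d \<noteq> 0" using z by (simp add: nonpole_def d_def N_def w_def)
  have zn: "z * z ^ (n - 1) = w" using n by (simp add: power_eq_if w_def)
  have "(cheb_factor n has_field_derivative (A' * d - 3 * A * (N + 1)) / (2 * d ^ 4)) (at w)"
  proof -
    have "((\<lambda>w. w * (N * (N + 1) * (2 * N + 1) * w\<^sup>2 - 2 * N * (N + 1) * w - N * (N - 1)))
        has_field_derivative A') (at w)"
      unfolding A'_def by (rule derivative_eq_intros refl)+ (simp add: algebra_simps power2_eq_square)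
    moreover have "((\<lambda>w. 2 * ((N + 1) * w - 1) ^ 3) has_field_derivative 6 * d\<^sup>2 * (N + 1)) (at w)"
      unfolding d_def by (rule derivative_eq_intros refl)+ (simp add: algebra_simps power2_eq_square)
    ultimately have "((\<lambda>w. w * (N * (N + 1) * (2 * N + 1) * w\<^sup>2 - 2 * N * (N + 1) * w - N * (N - 1))
        / (2 * ((N + 1) * w - 1) ^ 3)) has_field_derivative
        (A' * (2 * d ^ 3) - A * (6 * d\<^sup>2 * (N + 1))) / (2 * d ^ 3 * (2 * d ^ 3))) (at w)"
      using DERIV_divide d unfolding A_def d_def by fastforce
    moreover have "(A' * (2 * d ^ 3) - A * (6 * d\<^sup>2 * (N + 1))) / (2 * d ^ 3 * (2 * d ^ 3))
        = (A' * d - 3 * A * (N + 1)) / (2 * d ^ 4)"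
      using d by (simp add: divide_simps) (simp add: algebra_simps eval_nat_numeral)
    ultimately show ?thesis unfolding cheb_factor_def N_def by simp
  qed
  then have fac: "(cheb_factor n has_field_derivative (A' * d - 3 * A * (N + 1)) / (2 * d ^ 4)) (at (z ^ n))"
    by (simp add: w_def)
  have pw: "((\<lambda>z. z ^ n) has_field_derivative N * z ^ (n - 1)) (at z)"
    unfolding N_def by (rule derivative_eq_intros refl)+ simp
  have "(cheb n has_field_derivative
       (cheb_factor n w + (A' * d - 3 * A * (N + 1)) / (2 * d ^ 4) * (N * z ^ (n - 1)) * z)) (at z)"
    unfolding cheb_def
    by (rule derivative_eq_intros DERIV_chain2[OF fac pw] refl)+ (simp add: w_def)
  moreover have "cheb_factor n w + (A' * d - 3 * A * (N + 1)) / (2 * d ^ 4) * (N * z ^ (n - 1)) * z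
     = A / (2 * d ^ 3) + (A' * d - 3 * A * (N + 1)) / (2 * d ^ 4) * (N * (z * z ^ (n - 1)))"
    by (simp add: cheb_factor_def A_def d_def N_def algebra_simps)
  moreover have "\<dots> = (A * d + (A' * d - 3 * A * (N + 1)) * (N * w)) / (2 * d ^ 4)"
    unfolding zn using d by (simp add: field_simps power3_eq_cube power4_eq_xxxx)
  moreover have "A * d + (A' * d - 3 * A * (N + 1)) * (N * w)
     = N * (N + 1) * w * (w - 1)\<^sup>2 * ((N + 1) * (2 * N + 1) * w + (N - 1))"
    unfolding A_def A'_def d_def by (simp add: algebra_simps power2_eq_square)
  ultimately show ?thesis by (simp add: N_def w_def d_def)
qed

lemma pderiv_p_poly_nonzero: "n > 0 \<Longrightarrow> pderiv (p_poly n) \<noteq> 0"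
  using poly_pderiv_p_poly[of n 0] by (auto simp: power_0_left)

lemma finite_poles:
  assumes "n > 0" shows "finite {z :: complex. \<not> nonpole n z}"
  using poly_roots_finite[OF pderiv_p_poly_nonzero[OF assms]]
  by (simp add: poly_pderiv_p_poly[OF assms] nonpole_def)

lemma open_nonpole: "n > 0 \<Longrightarrow> open {z :: complex. nonpole n z}"
  using finite_imp_closed[OF finite_poles] by (simp add: closed_def Collect_neg_eq)

lemma eventually_nonpole:
  assumes "n > 0" shows "\<forall>\<^sub>F z :: complex in at a. nonpole n z"
proof -
  have "open (- ({z. \<not> nonpole n z} - {a}))"
    using finite_poles[OF assms] by (intro open_Compl finite_imp_closed) auto
  then show ?thesis
    unfolding eventually_at_topological by (intro exI[of _ "- ({z. \<not> nonpole n z} - {a})"]) auto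
qed

lemma isCont_cheb: "n > 0 \<Longrightarrow> nonpole n z \<Longrightarrow> isCont (cheb n) z"
  using has_field_derivative_cheb DERIV_isCont by blast

text \<open>Nothing cancels at a pole: where \<open>z ^ n = 1 / (N + 1)\<close>, the quadratic factor of the numerator is
\<open>- N ^ 3 / (N + 1)\<close>.\<close>

lemma cheb_at_pole:
  assumes n: "n > 1" and z: "\<not> nonpole n (z :: complex)"
  shows "filterlim (cheb n) at_infinity (at z)"
proof -
  define N :: complex where "N = of_nat n"
  have N: "N \<noteq> 0" "N + 1 \<noteq> 0" using n by (auto simp: N_def add.commute dest: of_nat_eq_0_iff[THEN iffD1])
     (metis of_nat_Suc of_nat_eq_0_iff nat.simps(3))
  have zn: "(N + 1) * z ^ n = 1" using z by (simp add: nonpole_def N_def)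
  define A where "A = (\<lambda>z. z * (z ^ n * (N * (N + 1) * (2 * N + 1) * (z ^ n)\<^sup>2
      - 2 * N * (N + 1) * z ^ n - N * (N - 1))))"
  define B where "B = (\<lambda>z. 2 * ((N + 1) * z ^ n - 1) ^ 3)"
  have "filterlim (\<lambda>\<zeta>. A \<zeta> / B \<zeta>) at_infinity (at z)"
  proof (rule filterlim_divide_at_infinity)
    show "(A \<longlongrightarrow> A z) (at z)" unfolding A_def by (intro tendsto_intros)
    have "(B \<longlongrightarrow> B z) (at z)" unfolding B_def by (intro tendsto_intros)
    moreover have "B z = 0" by (simp add: B_def zn)
    moreover have "\<forall>\<^sub>F \<zeta> in at z. B \<zeta> \<noteq> 0"
      using eventually_nonpole[of n z] n
      by (auto simp: B_def nonpole_def N_def elim!: eventually_mono)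
    ultimately show "filterlim B (at 0) (at z)" by (simp add: filterlim_at)
    have w: "z ^ n = 1 / (N + 1)" using zn N by (simp add: field_simps)
    have "z \<noteq> 0" using zn n by (auto simp: power_0_left)
    moreover have "N * (N + 1) * (2 * N + 1) * (z ^ n)\<^sup>2 - 2 * N * (N + 1) * z ^ n - N * (N - 1)
        = - (N ^ 3) / (N + 1)"
      unfolding w using N by (simp add: divide_simps) (simp add: algebra_simps eval_nat_numeral)
    ultimately show "A z \<noteq> 0" using N by (simp add: A_def w)
  qed
  moreover have "A \<zeta> / B \<zeta> = cheb n \<zeta>" for \<zeta> by (simp add: A_def B_def cheb_def cheb_factor_def N_def)
  ultimately show ?thesis by simp
qed

text \<open>Infinity is a fixed point of the map because this limit is not zero.\<close>

lemma cheb_factor_at_infinity: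
  "(cheb_factor n \<longlongrightarrow> of_nat n * (of_nat n + 1) * (2 * of_nat n + 1) / (2 * (of_nat n + 1) ^ 3))
     (at_infinity :: complex filter)"
proof -
  define N :: complex where "N = of_nat n"
  have N: "N + 1 \<noteq> 0" by (metis N_def of_nat_Suc of_nat_eq_0_iff nat.simps(3) add.commute)
  \<comment> \<open>\<open>\<psi>\<close> is the factor in the coordinate \<open>v = 1 / w\<close>.\<close>
  define \<psi> where "\<psi> = (\<lambda>v. (N * (N + 1) * (2 * N + 1) - 2 * N * (N + 1) * v - N * (N - 1) * v\<^sup>2)
      / (2 * ((N + 1) - v) ^ 3))"
  have "((\<lambda>w. \<psi> (inverse w)) \<longlongrightarrow> \<psi> 0) at_infinity"
    unfolding \<psi>_def by (rule tendsto_eq_intros tendsto_inverse_0 refl | use N in simp)+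
  moreover have "\<forall>\<^sub>F w in at_infinity. \<psi> (inverse w) = cheb_factor n w"
    using eventually_not_equal_at_infinity[of 0]
  proof eventually_elim
    case (elim w)
    have 1: "(N + 1) - inverse w = ((N + 1) * w - 1) / w" using elim by (simp add: field_simps)
    have 2: "N * (N + 1) * (2 * N + 1) - 2 * N * (N + 1) * inverse w - N * (N - 1) * (inverse w)\<^sup>2
        = (N * (N + 1) * (2 * N + 1) * w\<^sup>2 - 2 * N * (N + 1) * w - N * (N - 1)) / w\<^sup>2"
      using elim by (simp add: field_simps power2_eq_square)
    show ?case unfolding \<psi>_def cheb_factor_def N_def[symmetric] 1 2
      using elim by (simp add: power_divide eval_nat_numeral)
  qed
  ultimately have "(cheb_factor n \<longlongrightarrow> \<psi> 0) at_infinity"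
    using tendsto_cong by force
  then show ?thesis by (simp add: \<psi>_def N_def)
qed

lemma cheb_at_infinity:
  assumes n: "n > 1"
  shows "filterlim (cheb n) at_infinity (at_infinity :: complex filter)"
  unfolding cheb_def
proof (subst mult.commute, rule tendsto_mult_filterlim_at_infinity)
  show "((\<lambda>x. cheb_factor n (x ^ n)) \<longlongrightarrow>
     of_nat n * (of_nat n + 1) * (2 * of_nat n + 1) / (2 * (of_nat n + 1) ^ 3)) (at_infinity :: complex filter)"
    by (rule filterlim_compose[OF cheb_factor_at_infinity filterlim_power_at_infinity])
      (use n in simp)
  have "of_nat n \<noteq> (0::complex)" "of_nat n + 1 \<noteq> (0::complex)" "2 * of_nat n + 1 \<noteq> (0::complex)"
    using n of_nat_neq_0[of n, where 'a=complex] of_nat_neq_0[of "2*n", where 'a=complex] by (auto simp: add.commute)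
  then show "of_nat n * (of_nat n + 1) * (2 * of_nat n + 1) / (2 * (of_nat n + 1) ^ 3) \<noteq> (0::complex)"
    by simp
qed (rule filterlim_ident)

lemma chebyshev_map_p_poly:
  assumes n: "n > 1"
  shows "nonpole n z \<Longrightarrow> chebyshev_map (p_poly n) (Plane z) = Plane (cheb n z)"
    and "\<not> nonpole n z \<Longrightarrow> chebyshev_map (p_poly n) (Plane z) = Infinity"
    and "chebyshev_map (p_poly n) Infinity = Infinity"
proof -
  define G where "G = (\<lambda>z. z - (1 + 1/2 * chebyshev_L (p_poly n) z) *
      (poly (p_poly n) z / poly (pderiv (p_poly n)) z))"
  have map: "chebyshev_map (p_poly n) = sphere_map G" by (simp add: chebyshev_map_def G_def)
  have G: "G z = cheb n z" if "nonpole n z" for z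
    using chebyshev_formula[OF _ that] n by (simp add: G_def)
  have ev: "\<forall>\<^sub>F \<zeta> in at z. cheb n \<zeta> = G \<zeta>" for z
    using eventually_nonpole[of n z] n by (auto simp: G elim!: eventually_mono)
  show "chebyshev_map (p_poly n) (Plane z) = Plane (cheb n z)" if "nonpole n z"
    unfolding map
  proof (rule sphere_map_Plane)
    have "(cheb n \<longlongrightarrow> cheb n z) (at z)" using isCont_cheb[OF _ that] n by (simp add: isCont_def)
    then show "(G \<longlongrightarrow> cheb n z) (at z)" using ev by (rule Lim_transform_eventually)
  qed
  show "chebyshev_map (p_poly n) (Plane z) = Infinity" if "\<not> nonpole n z"
    unfolding map
    by (rule sphere_map_pole)
      (use cheb_at_pole[OF n that] filterlim_cong[OF refl refl ev[of z]] in blast)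
  obtain b where b: "\<And>\<zeta> :: complex. \<not> nonpole n \<zeta> \<Longrightarrow> norm \<zeta> \<le> b"
    using finite_imp_bounded[OF finite_poles[of n]] n unfolding bounded_iff by auto
  have "nonpole n \<zeta>" if "b + 1 \<le> norm \<zeta>" for \<zeta> :: complex
    using b[of \<zeta>] that by linarith
  then have "\<forall>\<^sub>F \<zeta> :: complex in at_infinity. nonpole n \<zeta>"
    unfolding eventually_at_infinity by blast
  then have "\<forall>\<^sub>F \<zeta> in at_infinity. cheb n \<zeta> = G \<zeta>"
    by (auto simp: G elim!: eventually_mono)
  then show "chebyshev_map (p_poly n) Infinity = Infinity"
    unfolding map using cheb_at_infinity[OF n] filterlim_cong[OF refl refl]
    by (intro sphere_map_Infinity) blast
qed

section \<open>Transfer of the basin to the plane\<close>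

text \<open>The basin of the root \<open>1\<close> as a subset of the plane. An orbit that hits a pole is mapped to infinity,
which is fixed, so the points of the basin are exactly those whose orbits meet no pole and converge.\<close>

definition plane_basin :: "nat \<Rightarrow> complex set" where
  "plane_basin n = {u. (\<forall>m. nonpole n ((cheb n ^^ m) u)) \<and> (\<lambda>m. (cheb n ^^ m) u) \<longlonglongrightarrow> 1}"

lemma cheb_rotate: "\<omega> ^ n = 1 \<Longrightarrow> cheb n (\<omega> * u) = \<omega> * cheb n u"
  by (simp add: cheb_def power_mult_distrib)

text \<open>Since the map commutes with the rotation by \<open>\<omega>\<close>, every root is reduced to the root \<open>1\<close>.\<close>

lemma basin_eq_rotated_plane_basin:
  assumes n: "n > 1" and \<omega>: "\<omega> ^ n = 1"
  shows "basin (chebyshev_map (p_poly n)) (Plane \<omega>) = (\<lambda>u. Plane (\<omega> * u)) ` plane_basin n"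
proof -
  define T where "T = chebyshev_map (p_poly n)"
  define h where "h = (\<lambda>u. Plane (\<omega> * u))"
  have \<omega>0: "\<omega> \<noteq> 0" using \<omega> n by (auto simp: power_0_left split: if_splits)
  have np: "nonpole n (\<omega> * u) \<longleftrightarrow> nonpole n u" for u
    by (simp add: nonpole_def power_mult_distrib \<omega>)
  have T: "T (h u) = (if nonpole n u then h (cheb n u) else Infinity)" for u
    by (simp add: T_def h_def chebyshev_map_p_poly[OF n] np cheb_rotate[OF \<omega>])
  have TI: "(T ^^ m) Infinity = Infinity" for m
    by (induction m) (simp_all add: T_def chebyshev_map_p_poly[OF n])
  have not_lim: "\<not> (\<lambda>m. (T ^^ m) z) \<longlonglongrightarrow> Plane \<omega>" if "(T ^^ k) z = Infinity" for z k
  proof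
    assume "(\<lambda>m. (T ^^ m) z) \<longlonglongrightarrow> Plane \<omega>"
    then have "(\<lambda>m. (T ^^ m) ((T ^^ k) z)) \<longlonglongrightarrow> Plane \<omega>" by (simp add: iterates_tail)
    then have "(\<lambda>m. Infinity) \<longlonglongrightarrow> Plane \<omega>" by (simp add: that TI)
    then show False using LIMSEQ_const_iff by blast
  qed
  have orbit: "(T ^^ m) (h u) = h ((cheb n ^^ m) u)" if "\<And>k. k < m \<Longrightarrow> nonpole n ((cheb n ^^ k) u)" for m u
    using that by (induction m) (auto simp: T)
  have lim_iff: "(\<lambda>m. h (g m)) \<longlonglongrightarrow> Plane \<omega> \<longleftrightarrow> g \<longlonglongrightarrow> 1" for g
  proof -
    have "(\<lambda>m. \<omega> * g m) \<longlonglongrightarrow> \<omega> * 1 \<longleftrightarrow> g \<longlonglongrightarrow> 1"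
      using \<omega>0 tendsto_mult_left[of g 1 sequentially \<omega>] tendsto_mult_left[of "\<lambda>m. \<omega> * g m" "\<omega> * 1" sequentially "inverse \<omega>"]
      by (auto simp: mult.assoc[symmetric])
    then show ?thesis by (simp add: h_def tendsto_Plane_iff)
  qed
  have mem: "h u \<in> basin T (Plane \<omega>) \<longleftrightarrow> u \<in> plane_basin n" for u
  proof (cases "\<forall>m. nonpole n ((cheb n ^^ m) u)")
    case True
    then show ?thesis using lim_iff by (simp add: basin_def plane_basin_def orbit)
  next
    case False
    \<comment> \<open>The orbit of \<open>u\<close> in the plane agrees with the orbit on the sphere up to the first pole.\<close>
    define k where "k = (LEAST m. \<not> nonpole n ((cheb n ^^ m) u))"
    have k: "\<not> nonpole n ((cheb n ^^ k) u)" "\<And>m. m < k \<Longrightarrow> nonpole n ((cheb n ^^ m) u)"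
      using False LeastI_ex[of "\<lambda>m. \<not> nonpole n ((cheb n ^^ m) u)"] not_less_Least
      unfolding k_def by blast+
    have "(T ^^ Suc k) (h u) = Infinity" using k orbit[of k u] by (simp add: T)
    then have "h u \<notin> basin T (Plane \<omega>)" using not_lim by (simp only: basin_def) blast
    then show ?thesis using False by (simp add: plane_basin_def)
  qed
  have "z \<in> h ` plane_basin n" if z: "z \<in> basin T (Plane \<omega>)" for z
  proof (cases z)
    case (Plane x)
    then have "z = h (x / \<omega>)" using \<omega>0 by (simp add: h_def)
    with z mem show ?thesis by blast
  next
    case Infinity
    then show ?thesis using z not_lim[of 0 z] by (simp add: basin_def)
  qed
  then show ?thesis using mem unfolding T_def h_def by blast
qed

lemma homeomorphism_rotated_Plane:
  assumes "\<omega> \<noteq> 0"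
  shows "\<exists>g. homeomorphism S ((\<lambda>u. Plane (\<omega> * u)) ` S) (\<lambda>u. Plane (\<omega> * u)) g"
proof -
  define h where "h = (\<lambda>u. Plane (\<omega> * u))"
  have "continuous_on UNIV h"
    by (auto simp: continuous_on_def h_def tendsto_Plane_iff intro!: tendsto_intros)
  moreover have "inj h" using assms by (auto simp: h_def inj_def)
  moreover have "openin (top_of_set (range h)) (h ` U)" if "open U" for U
  proof -
    have "(\<lambda>u. \<omega> * u) ` U = (\<lambda>x. x / \<omega>) -` U"
      using assms by (auto simp: image_iff) (metis nonzero_mult_div_cancel_left times_divide_eq_right)
    moreover have "open ((\<lambda>x. x / \<omega>) -` U)"
      using assms by (intro open_vimage that continuous_intros) auto
    ultimately have "open ((\<lambda>u. \<omega> * u) ` U)" by simp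
    then have "open (h ` U)"
      using open_Plane_image[of "(\<lambda>u. \<omega> * u) ` U"] by (simp add: h_def image_image)
    moreover have "h ` U \<subseteq> range h" by blast
    ultimately show ?thesis by (intro open_subset)
  qed
  ultimately obtain g where "homeomorphism UNIV (range h) h g"
    using homeomorphism_injective_open_map[of UNIV h "range h"] by auto
  then have "homeomorphism S (h ` S) h g"
    by (rule homeomorphism_of_subsets) auto
  then show ?thesis unfolding h_def by blast
qed

lemma immediate_basin_eq_rotated_component:
  assumes n: "n > 1" and \<omega>: "\<omega> ^ n = 1" and 1: "1 \<in> plane_basin n"
  shows "immediate_basin (chebyshev_map (p_poly n)) (Plane \<omega>)
     = (\<lambda>u. Plane (\<omega> * u)) ` connected_component_set (plane_basin n) 1"
proof -
  have "\<omega> \<noteq> 0" using \<omega> n by (auto simp: power_0_left split: if_splits)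
  then obtain g where "homeomorphism (plane_basin n) ((\<lambda>u. Plane (\<omega> * u)) ` plane_basin n)
      (\<lambda>u. Plane (\<omega> * u)) g"
    using homeomorphism_rotated_Plane by blast
  from connected_component_set_homeomorphism[OF this 1] show ?thesis
    unfolding immediate_basin_def basin_eq_rotated_plane_basin[OF n \<omega>] by simp
qed

section \<open>Local attraction and openness of the basin\<close>

lemma cheb_1: "n > 0 \<Longrightarrow> cheb n (1 :: 'a::real_normed_field) = 1"
  by (simp add: cheb_def cheb_factor_def divide_simps) (simp add: algebra_simps eval_nat_numeral)

lemma nonpole_1: "n > 0 \<Longrightarrow> nonpole n (1 :: 'a::real_normed_field)"
  by (simp add: nonpole_def)

lemma attracting_ball_cheb:
  assumes n: "n > 0"
  obtains r where "r > 0"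
    and "\<And>z :: complex. z \<in> ball 1 r \<Longrightarrow> nonpole n z"
    and "\<And>z :: complex. z \<in> ball 1 r \<Longrightarrow> dist (cheb n z) 1 \<le> dist z 1 / 2"
proof -
  have "(cheb n has_field_derivative 0) (at (1 :: complex))"
    using has_field_derivative_cheb[OF n nonpole_1[OF n], where 'a=complex] by simp
  then have "\<forall>e>0. \<exists>d>0. \<forall>y :: complex. norm (y - 1) < d \<longrightarrow>
      norm (cheb n y - cheb n 1 - 0 * (y - 1)) \<le> e * norm (y - 1)"
    unfolding has_field_derivative_def has_derivative_at_alt by blast
  from this[rule_format, of "1/2", OF half_gt_zero[OF zero_less_one]]
  obtain d where d: "d > 0"
    "\<And>y :: complex. norm (y - 1) < d \<Longrightarrow> norm (cheb n y - cheb n 1) \<le> 1/2 * norm (y - 1)"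
    unfolding mult_zero_left diff_zero by blast
  obtain e where e: "e > 0" "ball 1 e \<subseteq> {z :: complex. nonpole n z}"
    using nonpole_1[OF n] by (auto intro: openE[OF open_nonpole[OF n], of 1])
  show thesis
  proof (rule that[of "min d e"])
    show "dist (cheb n z) 1 \<le> dist z 1 / 2" if "z \<in> ball 1 (min d e)" for z :: complex
      using d(2)[of z] that by (simp add: dist_norm norm_minus_commute cheb_1[OF n])
  qed (use d(1) e in auto)
qed

lemma plane_basin_step:
  assumes "u \<in> plane_basin n" shows "nonpole n u" and "cheb n u \<in> plane_basin n"
proof -
  have *: "(cheb n ^^ m) (cheb n u) = (cheb n ^^ Suc m) u" for m
    by (simp add: funpow_swap1)
  show "nonpole n u" using assms by (simp add: plane_basin_def) (metis funpow_0)
  have "(\<lambda>m. (cheb n ^^ m) ((cheb n ^^ 1) u)) \<longlonglongrightarrow> 1"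
    using assms unfolding iterates_tail plane_basin_def by blast
  moreover have "nonpole n ((cheb n ^^ m) (cheb n u))" for m
    unfolding * using assms unfolding plane_basin_def by blast
  ultimately show "cheb n u \<in> plane_basin n" by (simp add: plane_basin_def)
qed

lemma plane_basin_backward:
  assumes "nonpole n u" "cheb n u \<in> plane_basin n" shows "u \<in> plane_basin n"
proof -
  have *: "(cheb n ^^ m) (cheb n u) = (cheb n ^^ Suc m) u" for m
    by (simp add: funpow_swap1)
  have "nonpole n ((cheb n ^^ m) u)" for m
  proof (cases m)
    case (Suc k)
    have "nonpole n ((cheb n ^^ k) (cheb n u))" using assms(2) by (simp add: plane_basin_def)
    then show ?thesis unfolding * Suc .
  qed (use assms in simp)
  moreover have "(\<lambda>m. (cheb n ^^ m) ((cheb n ^^ 1) u)) \<longlonglongrightarrow> 1"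
    using assms(2) unfolding plane_basin_def by simp
  then have "(\<lambda>m. (cheb n ^^ m) u) \<longlonglongrightarrow> 1" unfolding iterates_tail .
  ultimately show ?thesis by (simp add: plane_basin_def)
qed

text \<open>The basin is the increasing union of the iterated preimages of an attracting disc, where preimages are
taken inside the open set on which the map is finite.\<close>

lemma open_plane_basin:
  assumes n: "n > 0" shows "open (plane_basin n)" and "1 \<in> plane_basin n"
proof -
  obtain r where r: "r > 0" "\<And>z :: complex. z \<in> ball 1 r \<Longrightarrow> nonpole n z"
    "\<And>z :: complex. z \<in> ball 1 r \<Longrightarrow> dist (cheb n z) 1 \<le> dist z 1 / 2"
    using attracting_ball_cheb[OF n] by blast
  have ball: "ball 1 r \<subseteq> plane_basin n"
    using attracting_ball_iterates[OF r(3)] r(2) unfolding plane_basin_def by blast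
  with r(1) show "1 \<in> plane_basin n" by auto
  define E where "E = rec_nat (ball (1 :: complex) r) (\<lambda>_ A. {z. nonpole n z} \<inter> cheb n -` A)"
  have E: "E 0 = ball 1 r" "E (Suc m) = {z. nonpole n z} \<inter> cheb n -` E m" for m
    by (simp_all add: E_def)
  have op: "open (E m)" for m
  proof (induction m)
    case (Suc m)
    have "continuous_on {z :: complex. nonpole n z} (cheb n)"
      using isCont_cheb[OF n] by (auto intro: continuous_at_imp_continuous_on)
    then show ?case using Suc open_nonpole[OF n] E(2) by (auto intro: continuous_open_preimage)
  qed (simp add: E)
  have sub: "E m \<subseteq> plane_basin n" for m
    by (induction m) (use ball plane_basin_backward in \<open>auto simp: E\<close>)
  have sup: "\<exists>m. u \<in> E m" if u: "u \<in> plane_basin n" for u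
  proof -
    have "u \<in> E m" if "(cheb n ^^ m) u \<in> ball 1 r" "u \<in> plane_basin n" for m u
      using that
    proof (induction m arbitrary: u)
      case (Suc m)
      have "cheb n u \<in> E m"
        using Suc.prems plane_basin_step(2) by (intro Suc.IH) (auto simp: funpow_swap1)
      then show ?case using plane_basin_step(1) Suc.prems(2) by (simp add: E)
    qed (simp add: E)
    moreover have "\<forall>\<^sub>F m in sequentially. (cheb n ^^ m) u \<in> ball 1 r"
      using u r(1) by (intro topological_tendstoD[where l=1]) (auto simp: plane_basin_def)
    moreover have "\<exists>m. (cheb n ^^ m) u \<in> ball 1 r"
      using calculation(2) eventually_happens[of _ sequentially] by auto
    ultimately show ?thesis using u by blast
  qed
  have "plane_basin n = (\<Union>m. E m)" using sub sup by auto
  then show "open (plane_basin n)" using op by auto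
qed

section \<open>The real ray from the root to infinity\<close>

lemma cheb_of_real: "cheb n (of_real x) = (of_real (cheb n x) :: complex)"
  by (simp add: cheb_def cheb_factor_def)

lemma one_less_Suc_mult_power:
  fixes x :: real
  assumes "n > 0" "x \<ge> 1" shows "1 < (real n + 1) * x ^ n"
proof -
  have "1 \<le> x ^ n" using assms by simp
  moreover have "0 < real n * x ^ n" using assms by (intro mult_pos_pos) auto
  ultimately show ?thesis by (simp add: distrib_right)
qed

lemma nonpole_real: "n > 0 \<Longrightarrow> (x :: real) \<ge> 1 \<Longrightarrow> nonpole n x"
  using one_less_Suc_mult_power[of n x] by (simp add: nonpole_def)

lemma nonpole_of_real: "nonpole n (of_real x :: complex) \<longleftrightarrow> nonpole n x"
proof -
  have "(of_nat n + 1) * of_real x ^ n = (of_real ((real n + 1) * x ^ n) :: complex)" by simp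
  then show ?thesis unfolding nonpole_def by (metis of_real_eq_1_iff)
qed

text \<open>To the right of the root the map is increasing, which gives the lower bound. For the upper bound, drop
the Chebyshev correction, which is a decrease, and compare the remaining Newton step
\<open>x * (w - 1) / ((N + 1) * w - 1)\<close>, where \<open>w = x ^ n\<close>, with \<open>(x - 1) / (N + 1)\<close> by means of \<open>x \<le> w\<close>.\<close>

lemma cheb_real_bounds:
  fixes x :: real
  assumes n: "n > 0" and x: "x \<ge> 1"
  shows "1 \<le> cheb n x" and "cheb n x - 1 \<le> (1 - 1 / (real n + 1)) * (x - 1)"
proof -
  have "cheb n 1 \<le> cheb n x"
  proof (rule DERIV_nonneg_imp_nondecreasing[OF x])
    fix y :: real assume y: "1 \<le> y" "y \<le> x"
    show "\<exists>D. (cheb n has_real_derivative D) (at y) \<and> D \<ge> 0"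
      using has_field_derivative_cheb[OF n nonpole_real[OF n y(1)]] y n by (intro exI conjI) auto
  qed
  then show "1 \<le> cheb n x" by (simp add: cheb_1[OF n])
  define N where "N = real n"
  define w where "w = x ^ n"
  define d where "d = (N + 1) * w - 1"
  have N: "N \<ge> 1" using n by (simp add: N_def)
  have w: "w \<ge> x" "w \<ge> 1" using x n self_le_power[of x n] by (auto simp: w_def)
  have d: "d > 0" "d \<le> (N + 1) * w"
  proof -
    have "(N + 1) * w \<ge> (1 + 1) * 1" using N w by (intro mult_mono) auto
    then show "d > 0" "d \<le> (N + 1) * w" by (auto simp: d_def)
  qed
  \<comment> \<open>Newton's step and Chebyshev's correction separated.\<close>
  have "cheb n x = x * (1 - (w - 1) / d - N * (N + 1) * w * (w - 1)\<^sup>2 / (2 * d ^ 3))"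
  proof -
    have "1 - (w - 1) / d - N * (N + 1) * w * (w - 1)\<^sup>2 / (2 * d ^ 3)
        = (2 * d ^ 3 - 2 * (w - 1) * d\<^sup>2 - N * (N + 1) * w * (w - 1)\<^sup>2) / (2 * d ^ 3)"
      using d(1) by (simp add: field_simps power2_eq_square power3_eq_cube)
    also have "2 * d ^ 3 - 2 * (w - 1) * d\<^sup>2 - N * (N + 1) * w * (w - 1)\<^sup>2
        = w * (N * (N + 1) * (2 * N + 1) * w\<^sup>2 - 2 * N * (N + 1) * w - N * (N - 1))"
      unfolding d_def by (simp add: algebra_simps power2_eq_square power3_eq_cube)
    finally show ?thesis by (simp add: cheb_def cheb_factor_def w_def N_def d_def)
  qed
  also have "\<dots> \<le> x * (1 - (w - 1) / d)"
    using x d N w by (intro mult_left_mono) auto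
  also have "\<dots> \<le> x * (1 - (w - 1) / ((N + 1) * w))"
    using x d w N by (intro mult_left_mono diff_left_mono divide_left_mono) auto
  also have "\<dots> \<le> 1 + (1 - 1 / (N + 1)) * (x - 1)"
    using x w N by (simp add: divide_simps) (simp add: algebra_simps)
  finally show "cheb n x - 1 \<le> (1 - 1 / (real n + 1)) * (x - 1)" by (simp add: N_def)
qed

lemma real_ray_subset_plane_basin:
  assumes n: "n > 0" and x: "x \<ge> 1"
  shows "of_real x \<in> plane_basin n"
proof -
  define q where "q = 1 - 1 / (real n + 1)"
  have q: "0 \<le> q" "q < 1" using n by (auto simp: q_def)
  have iter: "(cheb n ^^ m) (of_real x) = (of_real ((cheb n ^^ m) x) :: complex)" for m
    by (induction m) (simp_all add: cheb_of_real)
  have b: "1 \<le> (cheb n ^^ m) x \<and> (cheb n ^^ m) x - 1 \<le> q ^ m * (x - 1)" for m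
  proof (induction m)
    case (Suc m)
    let ?y = "(cheb n ^^ m) x"
    have "cheb n ?y - 1 \<le> q * (?y - 1)" using cheb_real_bounds(2)[OF n, of ?y] Suc by (simp add: q_def)
    also have "\<dots> \<le> q * (q ^ m * (x - 1))" using Suc q by (intro mult_left_mono) auto
    finally show ?case using cheb_real_bounds(1)[OF n, of ?y] Suc by simp
  qed (use x in simp)
  have "(\<lambda>m. (cheb n ^^ m) x) \<longlonglongrightarrow> 1"
  proof (rule tendsto_sandwich[of "\<lambda>_. 1" _ _ "\<lambda>m. 1 + q ^ m * (x - 1)"])
    have "(\<lambda>m. 1 + q ^ m * (x - 1)) \<longlonglongrightarrow> 1 + 0 * (x - 1)"
      using q by (intro tendsto_intros LIMSEQ_power_zero) auto
    then show "(\<lambda>m. 1 + q ^ m * (x - 1)) \<longlonglongrightarrow> 1" by simp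
    show "\<forall>\<^sub>F m in sequentially. (cheb n ^^ m) x \<le> 1 + q ^ m * (x - 1)"
      using b by (intro always_eventually allI) (metis add.commute diff_le_eq)
  qed (use b in auto)
  then have "(\<lambda>m. (cheb n ^^ m) (of_real x)) \<longlonglongrightarrow> (1 :: complex)"
    unfolding iter using tendsto_of_real by fastforce
  moreover have "nonpole n ((cheb n ^^ m) (of_real x) :: complex)" for m
    using b[of m] nonpole_real[OF n] by (simp add: iter nonpole_of_real)
  ultimately show ?thesis by (simp add: plane_basin_def)
qed

section \<open>Invariant lines and the sector\<close>

text \<open>The line through \<open>0\<close> and \<open>e\<close> is invariant because \<open>z ^ n\<close> is real on it, and it is closed. An orbit on
it cannot converge to \<open>1\<close>, which is not on the line.\<close>

lemma plane_basin_avoids_invariant_line: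
  assumes u: "u \<in> plane_basin n" and e: "e ^ n = -1" "norm e = 1" "Im e \<noteq> 0"
  shows "Im (u * cnj e) \<noteq> 0"
proof
  assume "Im (u * cnj e) = 0"
  have ee: "e * cnj e = 1" using e(2) by (simp add: complex_norm_square[symmetric])
  have step: "Im (cheb n z * cnj e) = 0" if "Im (z * cnj e) = 0" for z
  proof -
    define r where "r = Re (z * cnj e)"
    have "z * cnj e = of_real r" using that by (simp add: r_def complex_eq_iff)
    then have z: "z = of_real r * e" using ee by (metis mult.assoc mult.commute mult.right_neutral)
    have "cheb n z = of_real (r * cheb_factor n (- (r ^ n))) * e"
      unfolding cheb_def z power_mult_distrib e(1)
      by (simp add: cheb_factor_def)
    then have "cheb n z * cnj e = of_real (r * cheb_factor n (- (r ^ n)))"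
      using ee by (simp add: mult.assoc)
    then show ?thesis by (simp only: Im_complex_of_real)
  qed
  have "Im ((cheb n ^^ m) u * cnj e) = 0" for m
    by (induction m) (use \<open>Im (u * cnj e) = 0\<close> step in auto)
  moreover have "(\<lambda>m. Im ((cheb n ^^ m) u * cnj e)) \<longlonglongrightarrow> Im (1 * cnj e)"
    using u by (intro tendsto_intros) (simp add: plane_basin_def)
  ultimately have "Im (1 * cnj e) = 0" by (simp add: LIMSEQ_const_iff)
  then show False using e(3) by simp
qed

text \<open>The open sector \<open>\<bar>Arg z\<bar> < pi / n\<close>, written as an intersection of two open half planes, which makes its
convexity and its relation to the invariant lines immediate.\<close>

definition sector :: "nat \<Rightarrow> complex set" where
  "sector n = {z. Im (z * cnj (cis (pi / n))) < 0 \<and> Im (z * cis (pi / n)) > 0}"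

lemma sin_pi_over_pos: "n > 1 \<Longrightarrow> sin (pi / real n) > 0"
  by (intro sin_gt_zero) (auto simp: field_simps)

lemma one_in_sector: "n > 1 \<Longrightarrow> 1 \<in> sector n"
  by (simp add: sector_def sin_pi_over_pos)

lemma convex_sector: "convex (sector n)"
proof -
  have "sector n = (\<lambda>z. Im (z * cnj (cis (pi / n)))) -` {..<0} \<inter> (\<lambda>z. Im (z * cis (pi / n))) -` {0<..}"
    by (auto simp: sector_def)
  moreover have "linear (\<lambda>z. Im (z * c))" for c
    by (intro linearI) (auto simp: algebra_simps)
  ultimately show ?thesis
    by (simp only:) (intro convex_Int convex_linear_vimage convex_real_interval)
qed

lemma sector_polar:
  assumes n: "n > 1" and z: "z \<in> sector n"
  obtains r \<theta> where "r > 0" "\<bar>\<theta>\<bar> < pi / n" "z = of_real r * cis \<theta>"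
proof -
  define r where "r = cmod z"
  define \<theta> where "\<theta> = Arg z"
  have z0: "z \<noteq> 0" using z by (auto simp: sector_def)
  then have r: "r > 0" and zr: "z = of_real r * cis \<theta>"
    by (auto simp: r_def \<theta>_def) (metis rcis_cmod_Arg rcis_def)
  have \<theta>: "- pi < \<theta>" "\<theta> \<le> pi" using Arg_bounded[of z] by (auto simp: \<theta>_def)
  have im: "Im (z * cnj (cis (pi / n))) = r * sin (\<theta> - pi / n)" "Im (z * cis (pi / n)) = r * sin (\<theta> + pi / n)"
    by (simp_all add: zr sin_add sin_diff algebra_simps)
  then have s: "sin (\<theta> - pi / n) < 0" "sin (\<theta> + pi / n) > 0"
    using z r unfolding sector_def mem_Collect_eq im by (auto simp: zero_less_mult_iff mult_less_0_iff)
  have pn: "pi / n > 0" using n by simp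
  have "\<theta> < pi / n"
    using sin_ge_zero[of "\<theta> - pi / n"] s(1) \<theta> pn by force
  moreover have "\<theta> > - (pi / n)"
    using sin_ge_zero[of "- (\<theta> + pi / n)"] s(2) \<theta> pn unfolding sin_minus by force
  ultimately show thesis by (intro that[OF r _ zr]) (simp add: abs_less_iff)
qed

lemma connected_nonzero_imp_pos:
  fixes g :: "'a::topological_space \<Rightarrow> real"
  assumes "connected U" "continuous_on U g" "\<And>z. z \<in> U \<Longrightarrow> g z \<noteq> 0"
    and a: "a \<in> U" "0 < g a" and z: "z \<in> U"
  shows "0 < g z"
proof (rule ccontr)
  assume "\<not> 0 < g z"
  then have "0 \<in> g ` U"
    using connectedD_interval[OF connected_continuous_image[OF assms(2,1)], of "g z" "g a" 0] a z by simp
  then show False using assms(3) by auto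
qed

section \<open>Total argument of the map in the sector\<close>

text \<open>The absolute value of the argument. Unlike the argument itself it is continuous across the negative
real axis, and on either closed half plane it determines the argument up to a fixed sign.\<close>

definition abs_arg :: "complex \<Rightarrow> real" where
  "abs_arg x = arccos (Re x / cmod x)"

lemma Re_div_cmod_bounds: "- 1 \<le> Re x / cmod x" "Re x / cmod x \<le> 1"
proof -
  have "\<bar>Re x / cmod x\<bar> \<le> 1" by (cases "x = 0") (simp_all add: abs_Re_le_cmod)
  then show "- 1 \<le> Re x / cmod x" "Re x / cmod x \<le> 1" unfolding abs_le_iff by linarith+
qed

lemma continuous_on_abs_arg [continuous_intros]:
  assumes "continuous_on A g" "\<And>z. z \<in> A \<Longrightarrow> g z \<noteq> 0"
  shows "continuous_on A (\<lambda>z. abs_arg (g z))"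
  unfolding abs_arg_def
  using assms Re_div_cmod_bounds
  by (intro continuous_on_arccos continuous_intros ballI conjI) auto

text \<open>The sign \<open>s\<close> selects the closed upper (\<open>s = 1\<close>) or lower (\<open>s = -1\<close>) half plane.\<close>

lemma abs_arg_polar:
  assumes s: "s = 1 \<or> s = -1" and im: "s * Im x \<ge> 0"
  shows "x = of_real (cmod x) * cis (s * abs_arg x)"
proof (cases "x = 0")
  case False
  define c where "c = Re x / cmod x"
  have c: "-1 \<le> c" "c \<le> 1" using Re_div_cmod_bounds[of x] by (simp_all only: c_def)
  have "cos (abs_arg x) = c" "sin (abs_arg x) = sqrt (1 - c\<^sup>2)"
    using c by (simp_all add: abs_arg_def c_def[symmetric] sin_arccos)
  moreover have "sqrt (1 - c\<^sup>2) = s * Im x / cmod x"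
  proof (rule real_sqrt_unique)
    have "(cmod x)\<^sup>2 = (Re x)\<^sup>2 + (Im x)\<^sup>2" by (rule cmod_power2)
    then have "(s * Im x)\<^sup>2 = (cmod x)\<^sup>2 - (Re x)\<^sup>2" using s by auto
    then show "(s * Im x / cmod x)\<^sup>2 = 1 - c\<^sup>2"
      using False by (simp add: c_def power_divide diff_divide_distrib)
  qed (use im in simp)
  ultimately show ?thesis
    using s False by (auto simp: complex_eq_iff c_def)
qed simp

lemma abs_arg_of_real:
  "x > 0 \<Longrightarrow> abs_arg (of_real x) = 0" "x < 0 \<Longrightarrow> abs_arg (of_real x) = pi"
  by (auto simp: abs_arg_def)

text \<open>On the sector the power \<open>z ^ n\<close> stays on the same side of the real axis as \<open>z\<close>, so that in each factor
of the map the argument can be measured with the same sign.\<close>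

lemma sector_power_side:
  assumes n: "n > 1" and z: "z \<in> sector n" and s: "s = 1 \<or> s = -1" and im: "s * Im z \<ge> 0"
  shows "s * Im (z ^ n) \<ge> 0"
proof -
  obtain r \<theta> where r: "r > 0" and \<theta>: "\<bar>\<theta>\<bar> < pi / n" and zr: "z = of_real r * cis \<theta>"
    using sector_polar[OF n z] by blast
  have pn: "pi / n < pi" using n by (simp add: field_simps)
  have "Im z = r * sin \<theta>" by (simp add: zr)
  then have "s * sin \<theta> \<ge> 0" using im r s by (auto simp: zero_le_mult_iff mult_le_0_iff)
  then have "sin (s * \<theta>) \<ge> 0" using s by auto
  have "s * \<theta> \<ge> 0"
  proof (rule ccontr)
    assume "\<not> ?thesis"
    then have "sin (- (s * \<theta>)) > 0" using \<theta> pn s by (intro sin_gt_zero) auto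
    then show False using \<open>sin (s * \<theta>) \<ge> 0\<close> by simp
  qed
  moreover have "real n * (s * \<theta>) \<le> pi"
  proof -
    have "s * \<theta> \<le> pi / n" using \<theta> s by auto
    then show ?thesis using n by (simp add: field_simps)
  qed
  ultimately have "sin (real n * (s * \<theta>)) \<ge> 0" by (intro sin_ge_zero) auto
  moreover have "Im (z ^ n) = r ^ n * sin (real n * \<theta>)"
    by (simp add: zr power_mult_distrib Complex.DeMoivre of_real_power[symmetric] del: of_real_power)
  ultimately show ?thesis using s r by (auto simp: mult_nonneg_nonpos)
qed

text \<open>The only pole in the sector is the positive one.\<close>

lemma nonpole_in_sector:
  assumes n: "n > 1" and z: "z \<in> sector n" and p: "\<not> nonpole n z"
  shows "Im z = 0 \<and> (real n + 1) * Re z ^ n \<le> 1"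
proof -
  obtain r \<theta> where r: "r > 0" and \<theta>: "\<bar>\<theta>\<bar> < pi / n" and zr: "z = of_real r * cis \<theta>"
    using sector_polar[OF n z] by blast
  have zn: "z ^ n = of_real (r ^ n) * cis (real n * \<theta>)"
    by (simp add: zr power_mult_distrib Complex.DeMoivre)
  have eq: "(of_nat n + 1) * z ^ n = of_real ((real n + 1) * r ^ n) * cis (real n * \<theta>)"
    unfolding zn by simp
  have e: "of_real ((real n + 1) * r ^ n) * cis (real n * \<theta>) = 1"
    by (rule trans[OF eq[symmetric]]) (use p in \<open>simp add: nonpole_def\<close>)
  from arg_cong[OF this, of Im] have "sin (real n * \<theta>) = 0" using r by simp
  moreover have "\<bar>real n * \<theta>\<bar> < pi" using \<theta> n by (simp add: abs_mult field_simps)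
  ultimately have "real n * \<theta> = 0" using sin_zero_pi_iff by blast
  then have "\<theta> = 0" using n by simp
  with zr have "z = of_real r" by simp
  moreover from e \<open>\<theta> = 0\<close> have "(real n + 1) * r ^ n = 1"
    by (metis cis_zero mult.right_neutral mult_zero_right of_real_eq_1_iff)
  ultimately show ?thesis by simp
qed

text \<open>The position of the roots relative to \<open>1 / (N + 1)\<close>, \<open>0\<close> and \<open>1\<close> comes from the signs of the quadratic
at \<open>1 / (N + 1)\<close> and at \<open>1\<close>, and from the negative product of the roots.\<close>

lemma cheb_numerator_roots:
  assumes n: "n > 1"
  obtains r1 r2 :: real where "r1 < 0" "1 / (real n + 1) < r2" "r2 < 1"
    "\<And>w :: complex. of_nat n * (of_nat n + 1) * (2 * of_nat n + 1) * w\<^sup>2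
        - 2 * of_nat n * (of_nat n + 1) * w - of_nat n * (of_nat n - 1)
      = of_real (real n * (real n + 1) * (2 * real n + 1)) * (w - of_real r1) * (w - of_real r2)"
proof -
  define N where "N = real n"
  have N: "N > 1" using n by (simp add: N_def)
  define a b c where "a = N * (N + 1) * (2 * N + 1)" and "b = 2 * N * (N + 1)" and "c = N * (N - 1)"
  have abc: "a > 0" "c > 0" using N by (auto simp: a_def c_def intro!: mult_pos_pos)
  define q where "q = (\<lambda>x. a * x\<^sup>2 - b * x - c)"
  have "q (1 / (N + 1)) = - (N ^ 3) / (N + 1)"
    unfolding q_def a_def b_def c_def using N by (simp add: divide_simps) (simp add: algebra_simps eval_nat_numeral)
  then have q0: "q (1 / (N + 1)) < 0" using N by simp
  have "q 1 = 2 * N ^ 3"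
    by (simp add: q_def a_def b_def c_def algebra_simps eval_nat_numeral)
  then have q1: "q 1 > 0" using N by simp
  have "continuous_on {1 / (N + 1)..1} q" unfolding q_def by (intro continuous_intros)
  then obtain r2 where r2: "1 / (N + 1) \<le> r2" "r2 \<le> 1" "q r2 = 0"
    using IVT'[of q "1 / (N + 1)" 0 1] q0 q1 N by (auto simp: field_simps)
  have r2': "1 / (N + 1) < r2" "r2 < 1" using r2 q0 q1 by (auto simp: order.order_iff_strict)
  have "r2 > 0" using r2'(1) N by (smt (verit) divide_nonneg_nonneg)
  define r1 where "r1 = - c / (a * r2)"
  have "r1 < 0" using abc \<open>r2 > 0\<close> by (simp add: r1_def)
  have prod: "a * (r1 * r2) = - c" using abc \<open>r2 > 0\<close> by (simp add: r1_def)
  have sum: "a * (r1 + r2) = b"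
  proof -
    have "a * (r1 + r2) * r2 = b * r2"
      using prod r2(3) by (simp add: q_def algebra_simps power2_eq_square)
    then show ?thesis using \<open>r2 > 0\<close> by simp
  qed
  have "complex_of_real a * w\<^sup>2 - of_real b * w - of_real c
      = of_real a * (w - of_real r1) * (w - of_real r2)" for w
  proof -
    have "of_real a * (w - of_real r1) * (w - of_real r2)
        = of_real a * w\<^sup>2 - of_real (a * (r1 + r2)) * w + of_real (a * (r1 * r2))"
      by (simp add: algebra_simps power2_eq_square)
    then show ?thesis unfolding sum prod by simp
  qed
  then have "of_nat n * (of_nat n + 1) * (2 * of_nat n + 1) * w\<^sup>2
        - 2 * of_nat n * (of_nat n + 1) * w - of_nat n * (of_nat n - 1)
      = of_real (real n * (real n + 1) * (2 * real n + 1)) * (w - of_real r1) * (w - of_real r2)" for w :: complex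
    by (simp add: a_def b_def c_def N_def)
  then show thesis using that \<open>r1 < 0\<close> r2' by (simp add: N_def)
qed

text \<open>The main step. Write the map as a constant times
\<open>z * w * (w - r1) * (w - r2) / (w - w0) ^ 3\<close> with \<open>w = z ^ n\<close> and \<open>r1 < 0 < w0 < r2 < 1\<close>, and add up
the arguments of the factors to a function \<open>A\<close>, measured in absolute value so that it is continuous
wherever no factor vanishes, hence on \<open>U\<close>. Then \<open>A\<close> is an argument of the image up to sign. It is \<open>0\<close> at the root \<open>1\<close>, but
\<open>- 2 * pi\<close> between \<open>0\<close> and the pole: there \<open>w - r2\<close> contributes \<open>pi\<close>, and the triple pole
contributes \<open>- 3 * pi\<close>. A connected set that contains points of both kinds contains a point with
\<open>A = - pi\<close>, which is mapped to the negative real axis and hence out of the sector. In other words, the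
preimage of the negative real axis separates the segment from the root.\<close>

lemma invariant_connected_avoids_pole_segment:
  assumes n: "n > 1" and U: "connected U" "1 \<in> U" "U \<subseteq> sector n"
    and np: "\<And>z. z \<in> U \<Longrightarrow> nonpole n z" and inv: "cheb n ` U \<subseteq> U"
    and x: "of_real x \<in> U"
  shows "(real n + 1) * x ^ n > 1"
proof (rule ccontr)
  assume neg: "\<not> ?thesis"
  define w0 where "w0 = 1 / (real n + 1)"
  obtain r1 r2 where roots: "r1 < 0" "w0 < r2" "r2 < 1"
    "\<And>w :: complex. of_nat n * (of_nat n + 1) * (2 * of_nat n + 1) * w\<^sup>2
        - 2 * of_nat n * (of_nat n + 1) * w - of_nat n * (of_nat n - 1)
      = of_real (real n * (real n + 1) * (2 * real n + 1)) * (w - of_real r1) * (w - of_real r2)"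
    using cheb_numerator_roots[OF n] unfolding w0_def by metis
  define K where "K = real n * (real n + 1) * (2 * real n + 1) / (2 * (real n + 1) ^ 3)"
  have K: "K > 0" using n by (simp add: K_def)
  have n1: "of_nat n + 1 \<noteq> (0 :: complex)" by (metis of_nat_Suc of_nat_eq_0_iff nat.simps(3) add.commute)
  have fact: "cheb n z = of_real K * (z * z ^ n * (z ^ n - of_real r1) * (z ^ n - of_real r2)
      / (z ^ n - of_real w0) ^ 3)" for z :: complex
  proof -
    have "(of_nat n + 1) * z ^ n - 1 = (of_nat n + 1) * (z ^ n - of_real w0)"
      using n1 by (simp add: w0_def algebra_simps)
    then show ?thesis
      unfolding cheb_def cheb_factor_def roots(4) by (simp add: K_def power_mult_distrib mult_ac)
  qed
  define A where "A = (\<lambda>z. abs_arg z + real n * abs_arg z + abs_arg (z ^ n - of_real r1)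
      + abs_arg (z ^ n - of_real r2) - 3 * abs_arg (z ^ n - of_real w0))"
  have nz: "cheb n z \<noteq> 0" if "z \<in> U" for z
  proof -
    have "cheb n z \<in> sector n" using that inv U(3) by blast
    then show ?thesis by (auto simp: sector_def)
  qed
  have factors: "z \<noteq> 0" "z ^ n - of_real r1 \<noteq> 0" "z ^ n - of_real r2 \<noteq> 0" "z ^ n - of_real w0 \<noteq> 0"
    if "z \<in> U" for z
    using nz[OF that] unfolding fact by auto
  have polar: "\<exists>\<rho>>0. \<exists>s. (s = 1 \<or> s = -1) \<and> cheb n z = of_real \<rho> * cis (s * A z)" if z: "z \<in> U" for z
  proof -
    \<comment> \<open>All factors lie on the same side of the real axis as \<open>z\<close>; \<open>s\<close> records the side.\<close>
    define s :: real where "s = (if Im z \<ge> 0 then 1 else -1)"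
    have s: "s = 1 \<or> s = -1" "s * Im z \<ge> 0" by (auto simp: s_def)
    have sn: "s * Im (z ^ n) \<ge> 0" using sector_power_side[OF n _ s] z U(3) by blast
    define w where "w = z ^ n"
    have pz: "z = of_real (cmod z) * cis (s * abs_arg z)" by (rule abs_arg_polar[OF s])
    have pw: "w = of_real (cmod z ^ n) * cis (real n * (s * abs_arg z))"
      unfolding w_def by (subst pz) (simp add: power_mult_distrib Complex.DeMoivre)
    have pd: "w - of_real t = of_real (cmod (w - of_real t)) * cis (s * abs_arg (w - of_real t))" for t
      by (rule abs_arg_polar[OF s(1)]) (use sn in \<open>simp add: w_def\<close>)
    define \<rho> where "\<rho> = K * (cmod z * cmod z ^ n * cmod (w - of_real r1) * cmod (w - of_real r2)
        / cmod (w - of_real w0) ^ 3)"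
    have "\<rho> > 0" unfolding \<rho>_def using K factors[OF z] by (simp add: w_def)
    moreover have "cheb n z = of_real \<rho> * cis (s * A z)"
    proof -
      have "cheb n z = of_real K * (z * w * (w - of_real r1) * (w - of_real r2) / (w - of_real w0) ^ 3)"
        unfolding fact w_def ..
      also have "\<dots> = of_real \<rho> * (cis (s * abs_arg z) * cis (real n * (s * abs_arg z))
           * cis (s * abs_arg (w - of_real r1)) * cis (s * abs_arg (w - of_real r2))
           / cis (s * abs_arg (w - of_real w0)) ^ 3)"
        apply (subst pz, subst pw, subst pd[of r1], subst pd[of r2], subst pd[of w0])
        by (simp add: \<rho>_def power_mult_distrib)
      also have "\<dots> = of_real \<rho> * cis (s * A z)"
        by (simp add: Complex.DeMoivre cis_mult cis_divide A_def w_def algebra_simps)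
      finally show ?thesis .
    qed
    ultimately show ?thesis using s(1) by blast
  qed
  have avoid: "A z \<noteq> - pi" if z: "z \<in> U" for z
  proof
    assume "A z = - pi"
    then obtain \<rho> where "\<rho> > 0" "cheb n z = - of_real \<rho>"
      using polar[OF z] cis_pi cis_cnj[of pi] by (auto simp: cis_cnj[symmetric] simp del: cis_cnj)
    moreover have "cheb n z \<in> sector n" using z inv U(3) by blast
    ultimately show False
      using sin_pi_over_pos[OF n] by (auto simp: sector_def zero_less_mult_iff mult_less_0_iff)
  qed
  have "continuous_on U A"
    unfolding A_def using factors by (intro continuous_intros) auto
  then have conn: "connected (A ` U)" using U(1) connected_continuous_image by blast
  have w0: "w0 < 1" using n by (simp add: w0_def field_simps)
  have "A 1 = 0"
  proof -
    have "abs_arg (1 - of_real t) = 0" if "t < 1" for t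
      using abs_arg_of_real(1)[of "1 - t"] that by simp
    moreover have "abs_arg 1 = 0" using abs_arg_of_real(1)[of 1] by simp
    ultimately show ?thesis using roots(1-3) w0 by (simp add: A_def)
  qed
  moreover have "A (of_real x) = - 2 * pi"
  proof -
    have x0: "x > 0"
      using x U(3) sin_pi_over_pos[OF n] by (auto simp: sector_def zero_less_mult_iff mult_less_0_iff)
    have "x ^ n \<le> w0" using neg n by (simp add: w0_def field_simps)
    moreover have "x ^ n \<noteq> w0" using np[OF x] n by (simp add: nonpole_of_real) (auto simp: nonpole_def w0_def field_simps)
    ultimately have lt: "x ^ n < w0" by simp
    have "abs_arg (of_real x ^ n - of_real t) = (if x ^ n < t then pi else 0)" if "x ^ n \<noteq> t" for t
      using abs_arg_of_real[of "x ^ n - t"] that by auto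
    moreover have "x ^ n > 0" using x0 by simp
    ultimately show ?thesis
      unfolding A_def using abs_arg_of_real(1)[OF x0] lt roots(1-3) by simp
  qed
  ultimately have "- pi \<in> A ` U"
    using connectedD_interval[OF conn imageI[OF x] imageI[OF U(2)], of "- pi"] by simp
  then show False using avoid unfolding image_iff by metis
qed

section \<open>The slit sector\<close>

text \<open>The sector without the segment from \<open>0\<close> to its pole: for a real point \<open>x\<close> of the sector the excluded
condition means that \<open>x\<close> is at most the pole.\<close>

definition slit_sector :: "nat \<Rightarrow> complex set" where
  "slit_sector n = {z \<in> sector n. \<not> (Im z = 0 \<and> (real n + 1) * Re z ^ n \<le> 1)}"

text \<open>The slit sector is star-shaped about \<open>1\<close>, so the ray that continues the segment from \<open>1\<close> to \<open>b\<close> beyond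
\<open>b\<close> does not return to it.\<close>

lemma slit_sector_escape:
  assumes n: "n > 1" and b: "b \<notin> slit_sector n"
  shows "\<exists>R. b \<in> R \<and> closed R \<and> connected R \<and> \<not> bounded R \<and> R \<inter> slit_sector n = {}"
proof -
  have b1: "b - 1 \<noteq> 0" using b n one_in_sector[OF n] by (auto simp: slit_sector_def)
  define g where "g = (\<lambda>t :: real. 1 + of_real t * (b - 1))"
  define R where "R = g ` {1..}"
  have "R = {z. Im ((z - 1) / (b - 1)) = 0 \<and> Re ((z - 1) / (b - 1)) \<ge> 1}"
  proof (intro equalityI subsetI)
    fix z assume z: "z \<in> {z. Im ((z - 1) / (b - 1)) = 0 \<and> Re ((z - 1) / (b - 1)) \<ge> 1}"
    then have "(z - 1) / (b - 1) = of_real (Re ((z - 1) / (b - 1)))" by (simp add: complex_eq_iff)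
    then have "z = g (Re ((z - 1) / (b - 1)))" using b1 by (simp add: g_def field_simps)
    then show "z \<in> R" using z unfolding R_def by blast
  qed (use b1 in \<open>auto simp: R_def g_def\<close>)
  moreover have "closed {z. Im ((z - 1) / (b - 1)) = 0 \<and> Re ((z - 1) / (b - 1)) \<ge> 1}"
    using b1 by (intro closed_Collect_conj closed_Collect_eq closed_Collect_le continuous_intros) auto
  ultimately have "closed R" by simp
  moreover have "connected R" unfolding R_def g_def
    by (intro connected_continuous_image continuous_intros) (simp add: convex_connected)
  moreover have "b \<in> R" unfolding R_def g_def by (rule image_eqI[of _ _ 1]) auto
  moreover have "\<not> bounded R"
  proof
    assume "bounded R"
    then obtain B where B: "\<And>z. z \<in> R \<Longrightarrow> norm z \<le> B" unfolding bounded_iff by blast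
    define t where "t = max 1 ((B + 2) / norm (b - 1))"
    have "t * norm (b - 1) \<ge> B + 2"
      using b1 by (simp add: t_def max_mult_distrib_right)
    moreover have "norm (g t) \<ge> norm (of_real t * (b - 1)) - norm (1 :: complex)"
      unfolding g_def using norm_triangle_ineq2[of "of_real t * (b - 1)" "- 1"] by (simp add: add.commute)
    moreover have "norm (of_real t * (b - 1)) = t * norm (b - 1)"
      by (simp add: norm_mult t_def)
    moreover have "norm (g t) \<le> B" by (rule B) (simp add: R_def t_def)
    ultimately show False by simp
  qed
  moreover have "R \<inter> slit_sector n = {}"
  proof (rule ccontr)
    assume "R \<inter> slit_sector n \<noteq> {}"
    then obtain t where t: "t \<ge> 1" "g t \<in> slit_sector n" unfolding R_def by auto
    have "b = (1 - 1 / t) *\<^sub>R 1 + (1 / t) *\<^sub>R g t"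
      using t(1) by (simp add: g_def scaleR_conv_of_real field_simps)
    moreover have "(1 - 1 / t) *\<^sub>R 1 + (1 / t) *\<^sub>R g t \<in> sector n"
      using t one_in_sector[OF n] by (intro convexD[OF convex_sector]) (auto simp: slit_sector_def)
    ultimately have bS: "b \<in> sector n" by simp
    with b have b0: "Im b = 0" "(real n + 1) * Re b ^ n \<le> 1" by (auto simp: slit_sector_def)
    have pos: "Re z > 0" if "z \<in> sector n" "Im z = 0" for z
      using that sin_pi_over_pos[OF n] by (auto simp: sector_def zero_less_mult_iff mult_less_0_iff)
    have "Re b \<le> 1"
      using one_less_Suc_mult_power[of n "Re b"] b0(2) n by force
    then have "(t - 1) * (Re b - 1) \<le> 0" using t(1) by (intro mult_nonneg_nonpos) auto
    then have "Re (g t) \<le> Re b" by (simp add: g_def algebra_simps)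
    moreover have "Im (g t) = 0" using b0 by (simp add: g_def)
    moreover from this have "Re (g t) > 0" using t(2) pos by (auto simp: slit_sector_def)
    ultimately have "(real n + 1) * Re (g t) ^ n \<le> (real n + 1) * Re b ^ n"
      by (intro mult_left_mono power_mono) auto
    then have "(real n + 1) * Re (g t) ^ n \<le> 1" using b0(2) by (rule order_trans)
    then show False using t(2) \<open>Im (g t) = 0\<close> by (simp add: slit_sector_def)
  qed
  ultimately show ?thesis by blast
qed

section \<open>The immediate basins of the non-zero roots\<close>

theorem theorem1:
  fixes n :: nat and \<omega> :: complex
  assumes "n > 1"
    and "poly (p_poly n) \<omega> = 0" and "\<omega> \<noteq> 0"
  shows "unbounded_in_plane (immediate_basin (chebyshev_map (p_poly n)) (Plane \<omega>))
       \<and> simply_connected (immediate_basin (chebyshev_map (p_poly n)) (Plane \<omega>))"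
proof -
  have n: "n > 1" "n > 0" using assms(1) by auto
  have \<omega>: "\<omega> ^ n = 1" using assms(2,3) by (simp add: poly_p_poly)
  \<comment> \<open>The immediate basin of the root \<open>1\<close> in the plane.\<close>
  define U where "U = connected_component_set (plane_basin n) 1"
  have 1: "1 \<in> plane_basin n" by (rule open_plane_basin(2)[OF n(2)])
  have eq: "immediate_basin (chebyshev_map (p_poly n)) (Plane \<omega>) = (\<lambda>u. Plane (\<omega> * u)) ` U"
    using immediate_basin_eq_rotated_component[OF n(1) \<omega> 1] by (simp add: U_def)
  have hom: "U homeomorphic (\<lambda>u. Plane (\<omega> * u)) ` U"
    using homeomorphism_rotated_Plane[OF assms(3)] unfolding homeomorphic_def by blast
  have Usub: "U \<subseteq> plane_basin n" unfolding U_def by (rule connected_component_subset)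
  have U: "open U" "connected U" "1 \<in> U"
    using open_plane_basin[OF n(2)] by (auto simp: U_def open_connected_component)
  \<comment> \<open>A connected part of the basin that meets its component \<open>U\<close> is contained in it.\<close>
  have max: "K \<subseteq> U" if K: "connected K" "K \<subseteq> plane_basin n" "K \<inter> U \<noteq> {}" for K
  proof -
    obtain k where k: "k \<in> K" "k \<in> U" using K(3) by blast
    have "K \<subseteq> connected_component_set (plane_basin n) k"
      using connected_component_maximal[OF k(1) K(1,2)] .
    then show ?thesis using connected_component_eq[of k "plane_basin n" 1] k(2) by (simp add: U_def)
  qed
  have np: "nonpole n z" if "z \<in> U" for z using that Usub plane_basin_step(1) by blast
  have contU: "continuous_on U (cheb n)"
    using isCont_cheb[OF n(2) np] by (intro continuous_at_imp_continuous_on) auto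
  have inv: "cheb n ` U \<subseteq> U"
  proof (rule max)
    show "connected (cheb n ` U)" using contU U(2) by (rule connected_continuous_image)
    show "cheb n ` U \<subseteq> plane_basin n" using Usub plane_basin_step(2) by blast
    show "cheb n ` U \<inter> U \<noteq> {}" using U(3) cheb_1[OF n(2), where 'a=complex] by force
  qed
  define e where "e = cis (pi / n)"
  have en: "e ^ n = -1" using n by (simp add: e_def Complex.DeMoivre)
  have "cnj e ^ n = -1" using en by (metis complex_cnj_minus complex_cnj_one complex_cnj_power)
  have avoid: "Im (z * cnj e) \<noteq> 0" "Im (z * e) \<noteq> 0" if "z \<in> U" for z
    using plane_basin_avoids_invariant_line[of z n e] plane_basin_avoids_invariant_line[of z n "cnj e"]
      that Usub en \<open>cnj e ^ n = -1\<close> sin_pi_over_pos[OF n(1)] by (auto simp: e_def)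
  have sect: "U \<subseteq> sector n"
  proof -
    have pos: "0 < - Im (1 * cnj e)" "0 < Im (1 * e)"
      using sin_pi_over_pos[OF n(1)] by (simp_all add: e_def)
    have "- Im (z * cnj e) \<noteq> 0" if "z \<in> U" for z
      using avoid(1)[OF that] by (simp only: neg_equal_0_iff_equal not_False_eq_True)
    then have "0 < - Im (z * cnj e)" if "z \<in> U" for z
      using that
      by (intro connected_nonzero_imp_pos[where g="\<lambda>z. - Im (z * cnj e)", OF U(2) _ _ U(3) pos(1)]
          continuous_intros)
    moreover have "0 < Im (z * e)" if "z \<in> U" for z
      by (rule connected_nonzero_imp_pos[where g="\<lambda>z. Im (z * e)", OF U(2) _ avoid(2) U(3) pos(2) that])
        (intro continuous_intros)
    ultimately show ?thesis by (auto simp: sector_def e_def)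
  qed
  have slit: "U \<subseteq> slit_sector n"
  proof
    fix z assume z: "z \<in> U"
    have "(real n + 1) * Re z ^ n > 1" if "Im z = 0"
    proof -
      have "z = of_real (Re z)" using that by (simp add: complex_eq_iff)
      then show ?thesis
        using invariant_connected_avoids_pole_segment[OF n(1) U(2,3) sect np inv, of "Re z"] z by simp
    qed
    then show "z \<in> slit_sector n" using z sect by (auto simp: slit_sector_def)
  qed
  have np_slit: "nonpole n z" if "z \<in> slit_sector n" for z
    using that nonpole_in_sector[OF n(1)] by (auto simp: slit_sector_def)
  have hol: "cheb n holomorphic_on slit_sector n"
    using has_field_derivative_cheb[OF n(2) np_slit]
    unfolding holomorphic_on_def field_differentiable_def
    by (blast intro: has_field_derivative_at_within)
  obtain r where r: "r > 0"
    "\<And>z :: complex. z \<in> ball 1 r \<Longrightarrow> nonpole n z"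
    "\<And>z :: complex. z \<in> ball 1 r \<Longrightarrow> dist (cheb n z) 1 \<le> dist z 1 / 2"
    by (rule attracting_ball_cheb[OF n(2)]) blast
  have "simply_connected U"
  proof (rule simply_connected_basin[OF U(1,2) inv _ r(1,3) hol slit slit_sector_escape[OF n(1)]])
    show "(\<lambda>m. (cheb n ^^ m) z) \<longlonglongrightarrow> 1" if "z \<in> U" for z
      using that Usub by (auto simp: plane_basin_def)
    show "K \<subseteq> U" if "connected K" "K \<inter> U \<noteq> {}"
      "\<And>z m. z \<in> K \<Longrightarrow> (cheb n ^^ m) z \<in> slit_sector n"
      "\<And>z. z \<in> K \<Longrightarrow> (\<lambda>m. (cheb n ^^ m) z) \<longlonglongrightarrow> 1" for K
    proof (rule max[OF that(1) _ that(2)])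
      show "K \<subseteq> plane_basin n"
        using that(3,4) np_slit unfolding plane_basin_def by blast
    qed
  qed
  then have sc: "simply_connected ((\<lambda>u. Plane (\<omega> * u)) ` U)"
    using homeomorphic_simply_connected[OF hom] by blast
  have ray: "of_real ` {1..} \<subseteq> U"
  proof (rule max)
    show "connected (complex_of_real ` {1..})"
      by (intro connected_continuous_image continuous_intros) (simp add: convex_connected)
    show "complex_of_real ` {1..} \<subseteq> plane_basin n" using real_ray_subset_plane_basin[OF n(2)] by auto
    show "complex_of_real ` {1..} \<inter> U \<noteq> {}" using U(3) by (force intro: image_eqI[of _ _ 1])
  qed
  have "\<not> bounded (Plane -` ((\<lambda>u. Plane (\<omega> * u)) ` U))"
  proof
    assume "bounded (Plane -` ((\<lambda>u. Plane (\<omega> * u)) ` U))"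
    then obtain B where B: "\<And>z. z \<in> Plane -` ((\<lambda>u. Plane (\<omega> * u)) ` U) \<Longrightarrow> norm z \<le> B"
      unfolding bounded_iff by blast
    have n\<omega>: "norm \<omega> = 1" using \<omega> n by (metis norm_one norm_power power_eq_1_iff norm_ge_zero less_irrefl)
    have "norm (\<omega> * of_real (max 1 (B + 1))) \<le> B"
      by (rule B) (use ray in \<open>auto intro!: image_eqI[OF refl]\<close>)
    then show False by (simp add: norm_mult n\<omega>)
  qed
  then show ?thesis unfolding eq unbounded_in_plane_def using sc by auto
qed

end
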